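(* Let $A\supset P$ be an inclusion of unital $C^*$-algebras with the Rohlin property. If $\mathrm{tsr}(A)=1$, then $\mathrm{tsr}(P)=1$.
   Context: A unital $C^*$-algebra $A$ has topological stable rank one, $\mathrm{tsr}(A)=1$, if the set of invertible elements of $A$ is dense in $A$. Inclusions of unital $C^*$-algebras have a common unit. For a conditional expectation $E:A\to P$, a quasi-basis is a finite set $\{(u_i,v_i)\}_{i=1}^n\subset A\times A$ with $a=\sum_i u_iE(v_ia)=\sum_i E(au_i)v_i$ for all $a\in A$. If one exists, $E$ has a finite index and $\mathrm{Index}\,E=\sum_i u_iv_i$ (independent of the choice; a positive central invertible element of $A$). Put $A^\infty=\ell^\infty(\mathbb{N},A)/c_0(A)$, $A$ being identified with the classes of constant sequences, and $A_\infty=A^\infty\cap A'$; $P^\infty$ is regarded as a subalgebra of $A^\infty$, and $E^\infty:A^\infty\to P^\infty$ is the termwise induced conditional expectation. A conditional expectation $E:A\to P$ with a finite index has the Rohlin property if there is a projection $e\in A_\infty$ with $E^\infty(e)=(\mathrm{Index}\,E)^{-1}\cdot1$ and such that the map $A\ni x\mapsto xe$ is injective. An inclusion $A\supset P$ has the Rohlin property if there is a conditional expectation $E:A\to P$ with a finite index having the Rohlin property. *)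

theory Defs
  imports "HOL-Analysis.Analysis"
begin

section \<open>Unital C*-algebras\<close>

class complex_star_algebra_1 = real_algebra_1 +
  fixes scaleC :: "complex \<Rightarrow> 'a \<Rightarrow> 'a"  (infixr \<open>*\<^sub>C\<close> 75)
    and star :: "'a \<Rightarrow> 'a"
  assumes scaleR_eq_scaleC: "scaleR r x = scaleC (complex_of_real r) x"
    and scaleC_add_right: "scaleC a (x + y) = scaleC a x + scaleC a y"
    and scaleC_add_left: "scaleC (a + b) x = scaleC a x + scaleC b x"
    and scaleC_scaleC: "scaleC a (scaleC b x) = scaleC (a * b) x"
    and mult_scaleC_left: "scaleC a x * y = scaleC a (x * y)"
    and mult_scaleC_right: "x * scaleC a y = scaleC a (x * y)"
    and star_star: "star (star x) = x"
    and star_add: "star (x + y) = star x + star y"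
    and star_mult: "star (x * y) = star y * star x"
    and star_scaleC: "star (scaleC a x) = scaleC (cnj a) (star x)"

class unital_cstar_algebra = complex_star_algebra_1 + real_normed_algebra_1 + banach +
  assumes norm_scaleC: "norm (scaleC a x) = cmod a * norm x"
    and cstar_identity: "norm (star x * x) = (norm x)\<^sup>2"

lemma star_zero: "star (0 :: 'a :: complex_star_algebra_1) = 0"
  using star_add[of "0 :: 'a" 0] by simp

lemma star_minus: "star (- x :: 'a :: complex_star_algebra_1) = - star x"
  using star_add[of x "- x"] by (simp add: star_zero eq_neg_iff_add_eq_0 add.commute)

lemma star_diff: "star (x - y :: 'a :: complex_star_algebra_1) = star x - star y"
  using star_add[of x "- y"] by (simp add: star_minus)

lemma star_one: "star (1 :: 'a :: complex_star_algebra_1) = 1"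
  by (metis mult.left_neutral mult.right_neutral star_mult star_star)

lemma scaleC_diff_right:
  "scaleC a (x - y) = scaleC a x - scaleC a (y :: 'a :: complex_star_algebra_1)"
  using scaleC_add_right[of a "x - y" y] by simp

lemma norm_star: "norm (star x) = norm (x :: 'a :: unital_cstar_algebra)"
proof -
  have le: "norm y \<le> norm (star y)" for y :: 'a
  proof (cases "norm y = 0")
    case False
    have "norm y * norm y \<le> norm (star y) * norm y"
      using norm_mult_ineq[of "star y" y] by (simp add: cstar_identity power2_eq_square)
    with False show ?thesis
      by (simp add: mult_le_cancel_right)
  qed auto
  from le[of x] le[of "star x"] show ?thesis
    by (simp add: star_star)
qed

text \<open>
  \<open>A\<close> is the whole type; \<open>P\<close> is a closed \<open>*\<close>-subalgebra containing the unit of \<open>A\<close>, with the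
  norm of \<open>A\<close>.
\<close>

definition unital_cstar_subalgebra :: "'a :: unital_cstar_algebra set \<Rightarrow> bool" where
  "unital_cstar_subalgebra P \<longleftrightarrow>
     1 \<in> P \<and>
     (\<forall>x\<in>P. \<forall>y\<in>P. x + y \<in> P \<and> x * y \<in> P) \<and>
     (\<forall>a. \<forall>x\<in>P. scaleC a x \<in> P) \<and>
     (\<forall>x\<in>P. star x \<in> P) \<and>
     closed P"

definition invertibles_of :: "'a :: ring_1 set \<Rightarrow> 'a set" where
  "invertibles_of B = {x \<in> B. \<exists>y\<in>B. x * y = 1 \<and> y * x = 1}"

definition tsr_eq_1 :: "'a :: unital_cstar_algebra set \<Rightarrow> bool" where
  "tsr_eq_1 B \<longleftrightarrow> B \<subseteq> closure (invertibles_of B)"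


section \<open>Conditional expectations of finite index\<close>

definition cstar_positive :: "'a :: unital_cstar_algebra \<Rightarrow> bool" where
  "cstar_positive x \<longleftrightarrow> (\<exists>y. x = star y * y)"

text \<open>
  By Tomiyama's theorem several of these clauses are redundant: a linear projection of norm one
  onto \<open>P\<close> is automatically a positive \<open>P\<close>-bimodule map.
\<close>

definition conditional_expectation ::
    "'a :: unital_cstar_algebra set \<Rightarrow> ('a \<Rightarrow> 'a) \<Rightarrow> bool" where
  "conditional_expectation P E \<longleftrightarrow>
     (\<forall>x. E x \<in> P) \<and>
     (\<forall>p\<in>P. E p = p) \<and>
     (\<forall>x y. E (x + y) = E x + E y) \<and>
     (\<forall>a x. E (scaleC a x) = scaleC a (E x)) \<and>
     (\<forall>p\<in>P. \<forall>x. E (p * x) = p * E x \<and> E (x * p) = E x * p) \<and>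
     (\<forall>x. cstar_positive x \<longrightarrow> cstar_positive (E x)) \<and>
     (\<forall>x. norm (E x) \<le> norm x)"

definition quasi_basis ::
    "('a :: unital_cstar_algebra \<Rightarrow> 'a) \<Rightarrow> nat \<Rightarrow> (nat \<Rightarrow> 'a) \<Rightarrow> (nat \<Rightarrow> 'a) \<Rightarrow> bool" where
  "quasi_basis E n u v \<longleftrightarrow>
     (\<forall>a. a = (\<Sum>i<n. u i * E (v i * a)) \<and> a = (\<Sum>i<n. E (a * u i) * v i))"

definition finite_index :: "('a :: unital_cstar_algebra \<Rightarrow> 'a) \<Rightarrow> bool" where
  "finite_index E \<longleftrightarrow> (\<exists>n u v. quasi_basis E n u v)"

definition cond_exp_index :: "('a :: unital_cstar_algebra \<Rightarrow> 'a) \<Rightarrow> 'a" where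
  "cond_exp_index E = (THE c. \<exists>n u v. quasi_basis E n u v \<and> c = (\<Sum>i<n. u i * v i))"

lemma quasi_basis_sum_unique:
  assumes "quasi_basis E n u v" "quasi_basis E m u' v'"
  shows "(\<Sum>i<n. u i * v i) = (\<Sum>j<m. u' j * v' j)"
proof -
  have "(\<Sum>i<n. u i * v i) = (\<Sum>i<n. (\<Sum>j<m. u' j * E (v' j * u i)) * v i)"
    using assms(2) by (intro sum.cong arg_cong2[where f = times]) (auto simp: quasi_basis_def)
  also have "\<dots> = (\<Sum>i<n. \<Sum>j<m. u' j * (E (v' j * u i) * v i))"
    by (simp add: sum_distrib_right mult.assoc)
  also have "\<dots> = (\<Sum>j<m. u' j * (\<Sum>i<n. E (v' j * u i) * v i))"
    by (subst sum.swap) (simp add: sum_distrib_left)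
  also have "\<dots> = (\<Sum>j<m. u' j * v' j)"
    using assms(1) by (intro sum.cong arg_cong2[where f = times]) (auto simp: quasi_basis_def)
  finally show ?thesis .
qed

lemma cond_exp_index_eq:
  assumes "quasi_basis E n u v"
  shows "cond_exp_index E = (\<Sum>i<n. u i * v i)"
  unfolding cond_exp_index_def using assms quasi_basis_sum_unique[OF _ assms] by blast


section \<open>The sequence algebra\<close>

text \<open>
  The relation is reflexive exactly on the bounded sequences, so its quotient is
  \<open>\<ell>\<^sup>\<infinity>(\<nat>, A) / c\<^sub>0(A)\<close>.  Only the \<open>*\<close>-algebra structure of this quotient enters the
  Rohlin property, so the quotient norm is not set up.
\<close>

definition seq_rel :: "(nat \<Rightarrow> 'a :: real_normed_vector) \<Rightarrow> (nat \<Rightarrow> 'a) \<Rightarrow> bool" where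
  "seq_rel f g \<longleftrightarrow> Bseq f \<and> Bseq g \<and> (\<lambda>n. f n - g n) \<longlonglongrightarrow> 0"

quotient_type (overloaded) 'a seq_alg = "nat \<Rightarrow> 'a :: real_normed_vector" / partial: seq_rel
proof (rule part_equivpI)
  show "\<exists>x :: nat \<Rightarrow> 'a. seq_rel x x"
    by (intro exI[of _ "\<lambda>_. 0"]) (auto simp: seq_rel_def)
  show "symp (seq_rel :: (nat \<Rightarrow> 'a) \<Rightarrow> _)"
    by (fastforce simp: symp_def seq_rel_def dest: tendsto_minus)
  show "transp (seq_rel :: (nat \<Rightarrow> 'a) \<Rightarrow> _)"
  proof (rule transpI)
    fix f g h :: "nat \<Rightarrow> 'a"
    assume "seq_rel f g" "seq_rel g h"
    then show "seq_rel f h"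
      using tendsto_add[of "\<lambda>n. f n - g n" 0 sequentially "\<lambda>n. g n - h n" 0]
      by (simp add: seq_rel_def)
  qed
qed

lemma seq_rel_map:
  assumes "seq_rel f g" and "\<And>x y. T (x - y) = T x - T y" and "\<And>x. norm (T x) \<le> K * norm x"
  shows "seq_rel (\<lambda>n. T (f n)) (\<lambda>n. T (g n))"
proof -
  have bd: "Bseq (\<lambda>n. T (h n))" if h: "Bseq h" for h
  proof -
    from h obtain B where B: "\<And>n. norm (h n) \<le> B"
      by (auto simp: Bseq_def)
    have "norm (T (h n)) \<le> \<bar>K\<bar> * B" for n
    proof -
      have "norm (T (h n)) \<le> K * norm (h n)"
        by (rule assms(3))
      also have "\<dots> \<le> \<bar>K\<bar> * B"
        using B[of n] by (intro mult_mono) auto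
      finally show ?thesis .
    qed
    then show ?thesis
      by (rule BseqI')
  qed
  have "(\<lambda>n. T (f n - g n)) \<longlonglongrightarrow> 0"
  proof (rule Lim_null_comparison)
    show "\<forall>\<^sub>F n in sequentially. norm (T (f n - g n)) \<le> K * norm (f n - g n)"
      using assms(3) by simp
    have "(\<lambda>n. norm (f n - g n)) \<longlonglongrightarrow> 0"
      using assms(1) by (auto simp: seq_rel_def intro: tendsto_norm_zero)
    then show "(\<lambda>n. K * norm (f n - g n)) \<longlonglongrightarrow> 0"
      by (rule tendsto_mult_right_zero)
  qed
  with assms(1) show ?thesis
    by (simp add: seq_rel_def assms(2) bd)
qed

lemma seq_rel_add:
  assumes "seq_rel f f'" "seq_rel g g'"
  shows "seq_rel (\<lambda>n. f n + g n) (\<lambda>n. f' n + g' n)"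
proof -
  have bd: "Bseq (\<lambda>n. f n + g n)" if "Bseq f" "Bseq g" for f g :: "nat \<Rightarrow> 'a"
  proof -
    from that obtain B C where "\<And>n. norm (f n) \<le> B" "\<And>n. norm (g n) \<le> C"
      by (auto simp: Bseq_def)
    then show ?thesis
      by (intro BseqI'[of _ "B + C"] norm_triangle_mono)
  qed
  have "(\<lambda>n. (f n - f' n) + (g n - g' n)) \<longlonglongrightarrow> 0 + 0"
    using assms by (intro tendsto_add) (auto simp: seq_rel_def)
  then show ?thesis
    using assms by (simp add: seq_rel_def bd algebra_simps)
qed

lemma seq_rel_uminus: "seq_rel f g \<Longrightarrow> seq_rel (\<lambda>n. - f n) (\<lambda>n. - g n)"
  by (rule seq_rel_map[where K = 1]) auto

lemma seq_rel_diff: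
  "seq_rel f f' \<Longrightarrow> seq_rel g g' \<Longrightarrow> seq_rel (\<lambda>n. f n - g n) (\<lambda>n. f' n - g' n)"
  using seq_rel_add[OF _ seq_rel_uminus] by simp

lemma seq_rel_mult:
  fixes f g :: "nat \<Rightarrow> 'a :: real_normed_algebra"
  assumes "seq_rel f f'" "seq_rel g g'"
  shows "seq_rel (\<lambda>n. f n * g n) (\<lambda>n. f' n * g' n)"
proof -
  have bd: "Bseq (\<lambda>n. f n * g n)" if "Bseq f" "Bseq g" for f g :: "nat \<Rightarrow> 'a"
  proof -
    from that obtain B C where "\<And>n. norm (f n) \<le> B" "\<And>n. norm (g n) \<le> C"
      by (auto simp: Bseq_def)
    then have "norm (f n * g n) \<le> B * C" for n
      using norm_mult_ineq[of "f n" "g n"] mult_mono'[of "norm (f n)" B "norm (g n)" C]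
      by (meson norm_ge_zero order_trans)
    then show ?thesis
      by (rule BseqI')
  qed
  have "Zfun (\<lambda>n. (f n - f' n) * g n) sequentially"
    using assms by (intro bounded_bilinear.Zfun_prod_Bfun[OF bounded_bilinear_mult])
      (auto simp: seq_rel_def tendsto_Zfun_iff)
  moreover have "Zfun (\<lambda>n. f' n * (g n - g' n)) sequentially"
    using assms by (intro bounded_bilinear.Bfun_prod_Zfun[OF bounded_bilinear_mult])
      (auto simp: seq_rel_def tendsto_Zfun_iff)
  ultimately have "Zfun (\<lambda>n. (f n - f' n) * g n + f' n * (g n - g' n)) sequentially"
    by (rule Zfun_add)
  then have "(\<lambda>n. f n * g n - f' n * g' n) \<longlonglongrightarrow> 0"
    by (simp add: tendsto_Zfun_iff algebra_simps)
  then show ?thesis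
    using assms by (simp add: seq_rel_def bd)
qed

lemma seq_rel_const: "seq_rel (\<lambda>_. a) (\<lambda>_. a)"
  by (auto simp: seq_rel_def)

lemma seq_rel_scaleR: "seq_rel f g \<Longrightarrow> seq_rel (\<lambda>n. scaleR r (f n)) (\<lambda>n. scaleR r (g n))"
  by (rule seq_rel_map) (auto simp: scaleR_diff_right)

lemma seq_rel_scaleC:
  fixes f g :: "nat \<Rightarrow> 'a :: unital_cstar_algebra"
  shows "seq_rel f g \<Longrightarrow> seq_rel (\<lambda>n. scaleC a (f n)) (\<lambda>n. scaleC a (g n))"
  by (rule seq_rel_map) (auto simp: scaleC_diff_right norm_scaleC)

lemma seq_rel_star:
  fixes f g :: "nat \<Rightarrow> 'a :: unital_cstar_algebra"
  shows "seq_rel f g \<Longrightarrow> seq_rel (\<lambda>n. star (f n)) (\<lambda>n. star (g n))"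
  by (rule seq_rel_map[where K = 1]) (auto simp: star_diff norm_star)

text \<open>The embedding of \<open>A\<close> as classes of constant sequences.\<close>

lift_definition const_seq :: "'a :: real_normed_vector \<Rightarrow> 'a seq_alg" is "\<lambda>a _. a"
  by (rule seq_rel_const)

instantiation seq_alg :: (unital_cstar_algebra) complex_star_algebra_1
begin

lift_definition zero_seq_alg :: "'a seq_alg" is "\<lambda>_. 0"
  by (rule seq_rel_const)
lift_definition one_seq_alg :: "'a seq_alg" is "\<lambda>_. 1"
  by (rule seq_rel_const)
lift_definition plus_seq_alg :: "'a seq_alg \<Rightarrow> 'a seq_alg \<Rightarrow> 'a seq_alg"
  is "\<lambda>f g n. f n + g n"
  by (rule seq_rel_add)
lift_definition uminus_seq_alg :: "'a seq_alg \<Rightarrow> 'a seq_alg" is "\<lambda>f n. - f n"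
  by (rule seq_rel_uminus)
lift_definition minus_seq_alg :: "'a seq_alg \<Rightarrow> 'a seq_alg \<Rightarrow> 'a seq_alg"
  is "\<lambda>f g n. f n - g n"
  by (rule seq_rel_diff)
lift_definition times_seq_alg :: "'a seq_alg \<Rightarrow> 'a seq_alg \<Rightarrow> 'a seq_alg"
  is "\<lambda>f g n. f n * g n"
  by (rule seq_rel_mult)
lift_definition scaleR_seq_alg :: "real \<Rightarrow> 'a seq_alg \<Rightarrow> 'a seq_alg" is "\<lambda>r f n. scaleR r (f n)"
  by (rule seq_rel_scaleR)
lift_definition scaleC_seq_alg :: "complex \<Rightarrow> 'a seq_alg \<Rightarrow> 'a seq_alg"
  is "\<lambda>a f n. scaleC a (f n)"
  by (rule seq_rel_scaleC)
lift_definition star_seq_alg :: "'a seq_alg \<Rightarrow> 'a seq_alg" is "\<lambda>f n. star (f n)"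
  by (rule seq_rel_star)

instance
proof
  show "(0 :: 'a seq_alg) \<noteq> 1"
    by transfer (auto simp: seq_rel_def LIMSEQ_const_iff)
  note intros = seq_rel_const seq_rel_add seq_rel_mult seq_rel_uminus seq_rel_scaleR
    seq_rel_scaleC seq_rel_star
  fix x y z :: "'a seq_alg" and r r' :: real and a b :: complex
  show "x + y + z = x + (y + z)"
    by transfer (simp add: add.assoc, intro intros; assumption)
  show "x + y = y + x"
    by transfer (simp add: add.commute seq_rel_add)
  show "0 + x = x"
    by transfer simp
  show "- x + x = 0"
    by transfer (simp add: seq_rel_const)
  show "x - y = x + - y"
    by transfer (simp add: seq_rel_diff)
  show "x * y * z = x * (y * z)"
    by transfer (simp add: mult.assoc, intro intros; assumption)
  show "1 * x = x" "x * 1 = x"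
    by (transfer, simp)+
  show "(x + y) * z = x * z + y * z"
    by transfer (simp add: distrib_right, intro intros; assumption)
  show "x * (y + z) = x * y + x * z"
    by transfer (simp add: distrib_left, intro intros; assumption)
  show "scaleR r (x + y) = scaleR r x + scaleR r y"
    by transfer (simp add: scaleR_add_right, intro intros; assumption)
  show "scaleR (r + r') x = scaleR r x + scaleR r' x"
    by transfer (simp add: scaleR_add_left, intro intros; assumption)
  show "scaleR r (scaleR r' x) = scaleR (r * r') x"
    by transfer (simp, intro intros; assumption)
  show "scaleR 1 x = x"
    by transfer simp
  show "scaleR r x * y = scaleR r (x * y)" "x * scaleR r y = scaleR r (x * y)"
    by (transfer, simp, intro intros; assumption)+
  show "scaleR r x = scaleC (complex_of_real r) x"
    by transfer (simp add: scaleR_eq_scaleC, intro intros; assumption)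
  show "scaleC a (x + y) = scaleC a x + scaleC a y"
    by transfer (simp add: scaleC_add_right, intro intros; assumption)
  show "scaleC (a + b) x = scaleC a x + scaleC b x"
    by transfer (simp add: scaleC_add_left, intro intros; assumption)
  show "scaleC a (scaleC b x) = scaleC (a * b) x"
    by transfer (simp add: scaleC_scaleC, intro intros; assumption)
  show "scaleC a x * y = scaleC a (x * y)"
    by transfer (simp add: mult_scaleC_left, intro intros; assumption)
  show "x * scaleC a y = scaleC a (x * y)"
    by transfer (simp add: mult_scaleC_right, intro intros; assumption)
  show "star (star x) = x"
    by transfer (simp add: star_star)
  show "star (x + y) = star x + star y"
    by transfer (simp add: star_add, intro intros; assumption)
  show "star (x * y) = star y * star x"
    by transfer (simp add: star_mult, intro intros; assumption)
  show "star (scaleC a x) = scaleC (cnj a) (star x)"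
    by transfer (simp add: star_scaleC, intro intros; assumption)
qed

end

definition seq_subalg :: "'a :: unital_cstar_algebra set \<Rightarrow> 'a seq_alg set" where
  "seq_subalg P = {abs_seq_alg f |f. Bseq f \<and> range f \<subseteq> P}"

definition central_seq_alg :: "'a :: unital_cstar_algebra seq_alg set" where
  "central_seq_alg = {x. \<forall>a. x * const_seq a = const_seq a * x}"

text \<open>
  The termwise map is evaluated at a chosen representing sequence; for a conditional expectation
  the choice is immaterial and the values lie in the subalgebra of \<open>P\<close>-valued sequences, as the two
  lemmas below show.
\<close>

definition induced_seq_map :: "('a \<Rightarrow> 'a) \<Rightarrow> 'a :: unital_cstar_algebra seq_alg \<Rightarrow> 'a seq_alg" where
  "induced_seq_map E x = abs_seq_alg (\<lambda>n. E (rep_seq_alg x n))"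

lemma conditional_expectation_diff:
  assumes "conditional_expectation P E"
  shows "E (x - y) = E x - E y"
proof -
  have "E (x - y + y) = E (x - y) + E y"
    using assms unfolding conditional_expectation_def by blast
  then show ?thesis
    by simp
qed

lemma conditional_expectation_seq_rel:
  assumes "conditional_expectation P E" "seq_rel f g"
  shows "seq_rel (\<lambda>n. E (f n)) (\<lambda>n. E (g n))"
proof (rule seq_rel_map[where T = E and K = 1 and f = f and g = g])
  show "norm (E x) \<le> 1 * norm x" for x
    using assms(1) by (auto simp: conditional_expectation_def)
qed (use assms conditional_expectation_diff in auto)

lemma induced_seq_map_abs:
  assumes "conditional_expectation P E" "Bseq f"
  shows "induced_seq_map E (abs_seq_alg f) = abs_seq_alg (\<lambda>n. E (f n))"
proof -
  have "seq_rel f f"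
    using assms(2) by (auto simp: seq_rel_def)
  then have "seq_rel (rep_seq_alg (abs_seq_alg f)) f"
    by (rule rep_abs_rsp_left[OF Quotient3_seq_alg])
  from conditional_expectation_seq_rel[OF assms(1) this] show ?thesis
    unfolding induced_seq_map_def by (rule Quotient3_rel_abs[OF Quotient3_seq_alg])
qed

lemma induced_seq_map_in_seq_subalg:
  assumes "conditional_expectation P E"
  shows "induced_seq_map E x \<in> seq_subalg P"
proof -
  have "seq_rel (rep_seq_alg x) (rep_seq_alg x)"
    by (rule Quotient3_rep_reflp[OF Quotient3_seq_alg])
  from conditional_expectation_seq_rel[OF assms this] assms show ?thesis
    unfolding induced_seq_map_def seq_subalg_def
    by (auto simp: seq_rel_def conditional_expectation_def)
qed


section \<open>The Rohlin property\<close>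

definition projection :: "'a :: complex_star_algebra_1 \<Rightarrow> bool" where
  "projection e \<longleftrightarrow> e * e = e \<and> star e = e"

text \<open>
  The element \<open>c\<close> is the inverse of the index, which is unique and always exists.
\<close>

definition expectation_rohlin ::
    "'a :: unital_cstar_algebra set \<Rightarrow> ('a \<Rightarrow> 'a) \<Rightarrow> bool" where
  "expectation_rohlin P E \<longleftrightarrow>
     conditional_expectation P E \<and> finite_index E \<and>
     (\<exists>e\<in>central_seq_alg. projection e \<and>
        (\<exists>c. c * cond_exp_index E = 1 \<and> cond_exp_index E * c = 1 \<and>
             induced_seq_map E e = const_seq c) \<and>
        inj (\<lambda>x. const_seq x * e))"

definition inclusion_rohlin :: "'a :: unital_cstar_algebra set \<Rightarrow> bool" where
  "inclusion_rohlin P \<longleftrightarrow> (\<exists>E. expectation_rohlin P E)"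

end

theory Submission
  imports Defs
begin

text \<open>
  Let \<open>c\<close> be the inverse of the index and \<open>\<beta> x = c\<^sup>-\<^sup>1 E\<^sup>\<infinity>(x e)\<close>, a bounded unital map from \<open>A\<close> to
  \<open>P\<^sup>\<infinity>\<close> that fixes \<open>P\<close>.  If \<open>\<beta>\<close> is multiplicative, it maps an invertible element of \<open>A\<close> close
  to \<open>x \<in> P\<close> to an invertible element of \<open>P\<^sup>\<infinity>\<close> close to \<open>x\<close>, and the late terms of a representing
  sequence are invertible in \<open>P\<close>.

  Multiplicativity follows from \<open>x e = \<beta> x e\<close>.  The form \<open>g x y = E\<^sup>\<infinity>(\<xi> x (\<xi> y\<^sup>*)\<^sup>*)\<close> of the defect
  \<open>\<xi> x = (x - \<beta> x) e\<close> is positive and \<open>P\<close>-balanced, and a computation with the quasi-basis gives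
  \<open>\<Sum>\<^sub>j g v\<^sub>j\<^sup>* u\<^sub>j\<^sup>* = 0\<close>.  Since no quasi-basis with \<open>v\<^sub>j = u\<^sub>j\<^sup>*\<close> is at hand, this sum is compared with
  \<open>\<Sum>\<^sub>k g v\<^sub>k\<^sup>* v\<^sub>k\<close> by applying the contraction \<open>K = 1 - t \<Sum>\<^sub>k v\<^sub>k\<^sup>* E(v\<^sub>k \<cdot>)\<close> to the \<open>v\<^sub>j\<^sup>*\<close>: the sums
  \<open>\<Sum>\<^sub>j g (K\<^sup>2\<^sup>m v\<^sub>j\<^sup>*) u\<^sub>j\<^sup>*\<close> decrease to \<open>0\<close>, the first decrement being at least \<open>t \<Sum>\<^sub>k g v\<^sub>k\<^sup>* v\<^sub>k\<close>.
  Hence \<open>\<xi> v\<^sub>k\<^sup>* = 0\<close> for all \<open>k\<close>, and \<open>\<xi> = 0\<close>.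
\<close>

section \<open>Positive elements of a unital C*-algebra\<close>

lemma scaleC_minus_left: "scaleC (- a) x = - scaleC a (x :: 'a :: complex_star_algebra_1)"
  using scaleC_add_left[of a "- a" x] scaleC_add_left[of 0 0 x]
  by (simp add: eq_neg_iff_add_eq_0 add.commute)

lemma scaleC_i_i: "\<i> *\<^sub>C \<i> *\<^sub>C x = - (x :: 'a :: complex_star_algebra_1)"
  using scaleR_eq_scaleC[of "-1" x] by (simp add: scaleC_scaleC)

lemma star_scaleR: "star (scaleR r x) = scaleR r (star (x :: 'a :: complex_star_algebra_1))"
  by (simp add: scaleR_eq_scaleC star_scaleC)

lemma star_sum: "star (\<Sum>i\<in>I. f i) = (\<Sum>i\<in>I. star (f i :: 'a :: complex_star_algebra_1))"
  by (induction I rule: infinite_finite_induct) (auto simp: star_add star_zero)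

lemmas star_simps = star_star star_add star_diff star_minus star_mult star_scaleR star_one star_zero

lemma tendsto_star:
  fixes f :: "'b \<Rightarrow> 'a :: unital_cstar_algebra"
  assumes "(f \<longlongrightarrow> l) F"
  shows "((\<lambda>x. star (f x)) \<longlongrightarrow> star l) F"
  using assms by (simp add: tendsto_iff dist_norm norm_star flip: star_diff)

text \<open>Hermitian elements and commutants serve as invariant closed sets for the square-root
  iteration below.\<close>

lemma closed_hermitian: "closed {x :: 'a :: unital_cstar_algebra. star x = x}"
  unfolding closed_sequential_limits
  by (auto intro: LIMSEQ_unique tendsto_star)

lemma closed_commutant: "closed {x :: 'a :: real_normed_algebra. x * w = w * x}"
  by (intro closed_Collect_eq continuous_intros)

section \<open>Square roots and the norm criterion for positivity\<close>

lemma norm_hermitian_square: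
  fixes x :: "'a :: unital_cstar_algebra"
  assumes "star x = x"
  shows "norm (x * x) = (norm x)\<^sup>2"
  using cstar_identity[of x] assms by simp

text \<open>
  The iteration \<open>y \<mapsto> (x + y\<^sup>2) / 2\<close> is dominated by the same iteration for the number \<open>x = 1\<close>,
  which increases to \<open>1\<close>.
\<close>

lemma exists_sqrt_one_minus:
  fixes x :: "'a :: {real_normed_algebra_1, banach}"
  assumes x: "norm x \<le> 1"
  obtains y where "(1 - y) * (1 - y) = 1 - x" "norm y \<le> 1"
    "\<And>S. closed S \<Longrightarrow> 0 \<in> S \<Longrightarrow> (\<And>z. z \<in> S \<Longrightarrow> (1/2) *\<^sub>R (x + z * z) \<in> S) \<Longrightarrow> y \<in> S"
proof -
  define Y where "Y = rec_nat (0 :: 'a) (\<lambda>_ y. (1/2) *\<^sub>R (x + y * y))"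
  define s where "s = rec_nat (0 :: real) (\<lambda>_ s. (1 + s * s) / 2)"
  have Y: "Y 0 = 0" "Y (Suc k) = (1/2) *\<^sub>R (x + Y k * Y k)" for k
    by (simp_all add: Y_def)
  have s: "s 0 = 0" "s (Suc k) = (1 + s k * s k) / 2" for k
    by (simp_all add: s_def)
  have s01: "0 \<le> s k \<and> s k \<le> 1" for k
  proof (induction k)
    case (Suc k)
    then have "s k * s k \<le> 1 * 1" by (intro mult_mono) auto
    then show ?case by (simp add: s)
  qed (simp add: s)
  \<comment> \<open>Everything commuting with \<open>x\<close> commutes with the iterates; hence the
    iterates commute with one another and the difference of squares in \<open>step\<close>
    factors.\<close>
  have comm: "w * Y k = Y k * w" if "w * x = x * w" for w k
  proof (induction k)
    case (Suc k)
    have "w * (Y k * Y k) = Y k * Y k * w"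
      using Suc by (metis mult.assoc)
    then show ?case using that by (simp add: Y distrib_left distrib_right)
  qed (simp add: Y)
  have commY: "Y j * Y k = Y k * Y j" for j k
    by (rule comm) (rule comm[symmetric, OF refl])
  have nY: "norm (Y k) \<le> s k" for k
  proof (induction k)
    case (Suc k)
    have "norm (x + Y k * Y k) \<le> norm x + norm (Y k) * norm (Y k)"
      by (meson norm_triangle_ineq norm_mult_ineq add_left_mono order_trans)
    also have "\<dots> \<le> 1 + s k * s k"
      using x Suc by (intro add_mono mult_mono) (use s01 in auto)
    finally show ?case by (simp add: Y s)
  qed (simp add: Y s)
  have step: "norm (Y (Suc k) - Y k) \<le> s (Suc k) - s k" for k
  proof (induction k)
    case (Suc k)
    have "Y (Suc (Suc k)) - Y (Suc k) = (1/2) *\<^sub>R ((Y (Suc k) - Y k) * (Y (Suc k) + Y k))"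
      using commY[of k "Suc k"]
      by (simp add: Y(2)[of "Suc k"] Y(2)[of k] del: Y(2))
         (simp add: Y(2)[of k, symmetric] algebra_simps)
    also have "norm \<dots> \<le> (1/2) * (norm (Y (Suc k) - Y k) * (norm (Y (Suc k)) + norm (Y k)))"
      by (simp, meson norm_mult_ineq norm_triangle_ineq mult_left_mono norm_ge_zero order_trans)
    also have "\<dots> \<le> (1/2) * ((s (Suc k) - s k) * (s (Suc k) + s k))"
      using Suc nY[of k] nY[of "Suc k"] order_trans[OF norm_ge_zero Suc]
      by (intro mult_mono add_mono) (auto intro: mult_nonneg_nonneg)
    also have "\<dots> = s (Suc (Suc k)) - s (Suc k)"
      by (simp add: s(2)[of "Suc k"]) (simp add: s(2)[of k] algebra_simps)
    finally show ?case .
  qed (use nY[of 1] Y s in \<open>simp\<close>)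
  have "summable (\<lambda>k. s (Suc k) - s k)"
  proof (rule summableI_nonneg_bounded)
    show "0 \<le> s (Suc k) - s k" for k
      using step[of k] norm_ge_zero order_trans by blast
    show "(\<Sum>i<k. s (Suc i) - s i) \<le> 1" for k
      using s01[of k] s(1) unfolding sum_lessThan_telescope by simp
  qed
  then have "summable (\<lambda>k. Y (Suc k) - Y k)"
    by (rule summable_comparison_test'[where N = 0]) (use step in auto)
  then have "convergent Y"
    unfolding summable_iff_convergent sum_lessThan_telescope by (simp add: Y)
  then obtain y where y: "Y \<longlonglongrightarrow> y"
    by (auto simp: convergent_def)
  have "(\<lambda>k. Y (Suc k)) \<longlonglongrightarrow> (1/2) *\<^sub>R (x + y * y)"
    unfolding Y by (intro tendsto_intros y)
  with LIMSEQ_Suc[OF y] have yfix: "y = (1/2) *\<^sub>R (x + y * y)"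
    using LIMSEQ_unique by blast
  have "y + y = x + y * y"
    by (subst (1 2) yfix) (simp flip: scaleR_add_left)
  then have "(1 - y) * (1 - y) = 1 - x"
    by (simp add: algebra_simps)
  moreover have "norm y \<le> 1"
    using tendsto_norm[OF y] by (rule Lim_bounded[where M = 0]) (use nY s01 order_trans in blast)
  \<comment> \<open>This clause carries hermiticity, commutation and membership in \<open>P\<close>
    to the root without exposing the iteration.\<close>
  moreover have "y \<in> S"
    if S: "closed S" "0 \<in> S" "\<And>z. z \<in> S \<Longrightarrow> (1/2) *\<^sub>R (x + z * z) \<in> S" for S
  proof -
    have "Y k \<in> S" for k
      by (induction k) (use S in \<open>auto simp: Y\<close>)
    with S(1) y show ?thesis
      by (metis closed_sequentially)
  qed
  ultimately show ?thesis
    using that by blast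
qed

text \<open>A provisional form of positivity, for which closure under sums is accessible first;
  \<open>hermitian_square_star_mult\<close> later shows that it agrees with
  \<open>cstar_positive\<close>.\<close>

definition hermitian_square :: "'a :: unital_cstar_algebra \<Rightarrow> bool" where
  "hermitian_square x \<longleftrightarrow> (\<exists>y. star y = y \<and> x = y * y)"

text \<open>For \<open>s > 0\<close>, dividing by \<open>s\<close> turns \<open>x\<close> into
  \<open>1\<close> minus a contraction. The root satisfies a norm condition of the same kind, so
  that roots can be iterated.\<close>

lemma exists_hermitian_sqrt:
  fixes x :: "'a :: unital_cstar_algebra"
  assumes x: "star x = x" "norm (s *\<^sub>R 1 - x) \<le> s"
  obtains y r where "star y = y" "y * y = x" "norm (r *\<^sub>R 1 - y) \<le> r"
    "\<And>w. w * x = x * w \<Longrightarrow> y * w = w * y"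
proof -
  have "s = 0 \<or> s > 0"
    using order_trans[OF norm_ge_zero x(2)] by auto
  then show ?thesis
  proof
    assume "s = 0"
    with x(2) have "x = 0" by simp
    then show ?thesis
      using that[of 0 0] by (simp add: star_zero)
  next
    assume s: "s > 0"
    define x' where "x' = 1 - (1 / s) *\<^sub>R x"
    have "x' = (1 / s) *\<^sub>R (s *\<^sub>R 1 - x)"
      using s by (simp add: x'_def scaleR_diff_right)
    then have nx': "norm x' \<le> 1"
      using x(2) s by simp
    obtain y where y: "(1 - y) * (1 - y) = 1 - x'" "norm y \<le> 1"
      and S: "\<And>S. closed S \<Longrightarrow> 0 \<in> S \<Longrightarrow> (\<And>z. z \<in> S \<Longrightarrow> (1/2) *\<^sub>R (x' + z * z) \<in> S) \<Longrightarrow> y \<in> S"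
      using exists_sqrt_one_minus[OF nx'] by metis
    have "star y = y"
      using S[OF closed_hermitian] x(1) by (simp add: star_simps x'_def)
    have comm: "y * w = w * y" if "w * x = x * w" for w
    proof -
      have "y \<in> {z. z * w = w * z}"
      proof (rule S[OF closed_commutant])
        fix z assume "z \<in> {z. z * w = w * z}"
        then have "z * z * w = w * (z * z)"
          by simp (metis mult.assoc)
        then show "(1/2) *\<^sub>R (x' + z * z) \<in> {z. z * w = w * z}"
          using that by (simp add: x'_def algebra_simps)
      qed simp
      then show ?thesis by simp
    qed
    define q where "q = sqrt s"
    have q: "q > 0" "q * q = s"
      using s by (simp_all add: q_def)
    show ?thesis
    proof (rule that[of "q *\<^sub>R (1 - y)" q])
      show "star (q *\<^sub>R (1 - y)) = q *\<^sub>R (1 - y)"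
        by (simp add: star_simps \<open>star y = y\<close>)
      show "q *\<^sub>R (1 - y) * q *\<^sub>R (1 - y) = x"
        using s by (simp add: y(1) q(2) x'_def)
      show "norm (q *\<^sub>R 1 - q *\<^sub>R (1 - y)) \<le> q"
        using y(2) q(1) by (simp add: scaleR_diff_right)
      show "q *\<^sub>R (1 - y) * w = w * q *\<^sub>R (1 - y)" if "w * x = x * w" for w
        using comm[OF that] by (simp add: algebra_simps)
    qed
  qed
qed

text \<open>The point is that \<open>y + \<i>z\<close> is unitary.\<close>

lemma norm_le_of_sum_squares:
  fixes y z :: "'a :: unital_cstar_algebra"
  assumes "star y = y" "star z = z" "y * z = z * y" "y * y + z * z = s *\<^sub>R 1" and s: "0 \<le> s"
  shows "(norm y)\<^sup>2 \<le> s"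
proof -
  define U where "U = y + \<i> *\<^sub>C z"
  have sU: "star U = y - \<i> *\<^sub>C z"
    using assms(1,2) by (simp add: U_def star_add star_scaleC scaleC_minus_left)
  have "star U * U = y * y + z * z"
    unfolding sU unfolding U_def
    by (simp add: algebra_simps scaleC_diff_right scaleC_add_right mult_scaleC_left mult_scaleC_right scaleC_i_i assms(3))
  then have "(norm U)\<^sup>2 = s"
    using s by (simp add: assms(4) flip: cstar_identity)
  then have nU: "norm U = sqrt s"
    by (metis norm_ge_zero real_sqrt_unique)
  have "norm (y + y) \<le> norm U + norm (star U)"
    using norm_triangle_ineq[of U "star U"] unfolding sU unfolding U_def by simp
  moreover have "norm (y + y) = 2 * norm y"
    by (metis norm_scaleR scaleR_2 abs_numeral)
  ultimately have "norm y \<le> sqrt s"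
    by (simp add: norm_star nU)
  then have "(norm y)\<^sup>2 \<le> (sqrt s)\<^sup>2"
    by (intro power_mono) auto
  then show ?thesis using s by simp
qed

text \<open>The norm condition places the spectrum in \<open>[0, 2s]\<close> and reduces sums of
  positive elements to the triangle inequality. For \<open>x = y * y\<close> and \<open>s\<close>
  the squared norm of \<open>y\<close>, a root of \<open>s - x\<close> commutes with
  \<open>y\<close>, and \<open>norm_le_of_sum_squares\<close> bounds it.\<close>

lemma hermitian_square_iff_norm:
  fixes x :: "'a :: unital_cstar_algebra"
  shows "hermitian_square x \<longleftrightarrow> star x = x \<and> (\<exists>s. norm (s *\<^sub>R 1 - x) \<le> s)"
proof
  assume "hermitian_square x"
  then obtain y where y: "star y = y" "x = y * y"
    by (auto simp: hermitian_square_def)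
  define s where "s = (norm y)\<^sup>2"
  have sx: "star (s *\<^sub>R 1 - x) = s *\<^sub>R 1 - x"
    using y by (simp add: star_simps)
  have "norm (s *\<^sub>R 1 - (s *\<^sub>R 1 - x)) \<le> s"
    using norm_hermitian_square[OF y(1)] by (simp add: y(2) s_def)
  from exists_hermitian_sqrt[OF sx this] obtain z where
    z: "star z = z" "z * z = s *\<^sub>R 1 - x" "\<And>w. w * (s *\<^sub>R 1 - x) = (s *\<^sub>R 1 - x) * w \<Longrightarrow> z * w = w * z"
    by metis
  have "z * y = y * z"
    by (rule z(3)) (simp add: y(2) algebra_simps)
  then have "(norm z)\<^sup>2 \<le> s"
    using y z(1,2) by (intro norm_le_of_sum_squares[of z y]) (auto simp: s_def)
  then have "norm (s *\<^sub>R 1 - x) \<le> s"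
    using norm_hermitian_square[OF z(1)] by (simp add: z(2))
  then show "star x = x \<and> (\<exists>s. norm (s *\<^sub>R 1 - x) \<le> s)"
    using y by (auto simp: star_simps)
next
  assume "star x = x \<and> (\<exists>s. norm (s *\<^sub>R 1 - x) \<le> s)"
  then show "hermitian_square x"
    unfolding hermitian_square_def by (metis exists_hermitian_sqrt)
qed

lemma hermitian_square_add:
  assumes "hermitian_square x" "hermitian_square y"
  shows "hermitian_square (x + y)"
proof -
  obtain s t where "norm (s *\<^sub>R 1 - x) \<le> s" "norm (t *\<^sub>R 1 - y) \<le> t"
    using assms by (auto simp: hermitian_square_iff_norm)
  then have "norm ((s + t) *\<^sub>R 1 - (x + y)) \<le> s + t"
    using norm_triangle_ineq[of "s *\<^sub>R 1 - x" "t *\<^sub>R 1 - y"] by (simp add: algebra_simps)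
  with assms show ?thesis
    unfolding hermitian_square_iff_norm star_add by auto
qed

lemma hermitian_square_scaleR:
  assumes "hermitian_square x" "0 \<le> r"
  shows "hermitian_square (r *\<^sub>R x)"
proof -
  obtain y where "star y = y" "x = y * y"
    using assms by (auto simp: hermitian_square_def)
  then show ?thesis
    unfolding hermitian_square_def using assms(2)
    by (intro exI[of _ "sqrt r *\<^sub>R y"]) (simp add: star_simps)
qed

lemma hermitian_square_norm_diff:
  assumes "star x = x" "norm x \<le> s"
  shows "hermitian_square (s *\<^sub>R 1 - x)"
  unfolding hermitian_square_iff_norm using assms
  by (auto simp: star_simps intro!: exI[of _ s])

text \<open>The root of \<open>s - x\<close> commutes with that of \<open>x\<close>, and their
  squares add up to \<open>s\<close>, so \<open>norm_le_of_sum_squares\<close> applies.\<close>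

lemma norm_le_of_hermitian_square_diff:
  assumes x: "hermitian_square x" and sx: "hermitian_square (s *\<^sub>R 1 - x)" and s: "0 \<le> s"
  shows "norm x \<le> s"
proof -
  obtain y where y: "star y = y" "x = y * y"
    using x by (auto simp: hermitian_square_def)
  obtain t where "star (s *\<^sub>R 1 - x) = s *\<^sub>R 1 - x" "norm (t *\<^sub>R 1 - (s *\<^sub>R 1 - x)) \<le> t"
    using sx unfolding hermitian_square_iff_norm by auto
  from exists_hermitian_sqrt[OF this] obtain z where
    z: "star z = z" "z * z = s *\<^sub>R 1 - x" "\<And>w. w * (s *\<^sub>R 1 - x) = (s *\<^sub>R 1 - x) * w \<Longrightarrow> z * w = w * z"
    by metis
  have "z * y = y * z"
    by (rule z(3)) (simp add: y(2) algebra_simps)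
  then have "(norm y)\<^sup>2 \<le> s"
    using y z(1,2) s by (intro norm_le_of_sum_squares[of y z]) auto
  then show ?thesis
    using norm_hermitian_square[OF y(1)] by (simp add: y(2))
qed

lemma hermitian_square_norm_mono:
  assumes "hermitian_square x" "hermitian_square y"
  shows "norm x \<le> norm (x + y)"
proof (rule norm_le_of_hermitian_square_diff[OF assms(1)])
  have "hermitian_square (norm (x + y) *\<^sub>R 1 - (x + y))"
    using assms by (intro hermitian_square_norm_diff)
      (auto simp: hermitian_square_iff_norm star_add)
  from hermitian_square_add[OF this assms(2)]
  show "hermitian_square (norm (x + y) *\<^sub>R 1 - x)" by (simp add: algebra_simps)
qed auto

section \<open>Positivity of \<open>star x * x\<close>\<close>

text \<open>
  Writing \<open>a = y y\<^sup>*\<close>, the hypotheses give \<open>(1 - a/s) y = y (1 + c/s)\<close>, where \<open>1 - a/s\<close> is a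
  contraction, whereas \<open>1 + c/s\<close> strictly increases the norm unless \<open>c = 0\<close>.
\<close>

lemma eq_0_if_star_mult_negative:
  fixes y c :: "'a :: unital_cstar_algebra"
  assumes c: "hermitian_square c" and yc: "star y * y = - c"
    and a: "hermitian_square (y * star y)"
  shows "y = 0"
proof -
  obtain s0 where s0: "norm (s0 *\<^sub>R 1 - y * star y) \<le> s0"
    using a by (auto simp: hermitian_square_iff_norm)
  define s where "s = s0 + 1"
  have s: "s > 0"
    using order_trans[OF norm_ge_zero s0] by (simp add: s_def)
  have ns: "norm (s *\<^sub>R 1 - y * star y) \<le> s"
    using norm_triangle_ineq[of "s0 *\<^sub>R 1 - y * star y" 1] s0 by (simp add: s_def algebra_simps)
  define d where "d = (1 / s) *\<^sub>R c"
  have d: "hermitian_square d"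
    unfolding d_def using c s by (intro hermitian_square_scaleR) auto
  then have sd: "star d = d"
    by (simp add: hermitian_square_iff_norm)
  have yd: "star y * y = - (s *\<^sub>R d)"
    using yc s by (simp add: d_def)
  have "(s *\<^sub>R 1 - y * star y) * y = s *\<^sub>R y - y * (star y * y)"
    by (simp add: left_diff_distrib mult.assoc)
  also have "\<dots> = s *\<^sub>R (y * (1 + d))"
    unfolding yd by (simp add: distrib_left scaleR_add_right)
  finally have "s *\<^sub>R (y * (1 + d)) = (s *\<^sub>R 1 - y * star y) * y" ..
  then have "s * norm (y * (1 + d)) \<le> s * norm y"
    using order_trans[OF norm_mult_ineq mult_right_mono[OF ns norm_ge_zero]] s
    by (metis abs_of_pos norm_scaleR)
  then have "(norm (y * (1 + d)))\<^sup>2 \<le> (norm y)\<^sup>2"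
    using s by (intro power_mono) auto
  then have "norm (star (y * (1 + d)) * (y * (1 + d))) \<le> norm (star y * y)"
    by (simp add: cstar_identity)
  moreover have "star (y * (1 + d)) * (y * (1 + d)) = - (s *\<^sub>R ((1 + d) * (d * (1 + d))))"
  proof -
    have "star (y * (1 + d)) * (y * (1 + d)) = (1 + d) * ((star y * y) * (1 + d))"
      by (simp only: star_mult star_add star_one sd mult.assoc)
    then show ?thesis unfolding yd by simp
  qed
  ultimately have "norm ((1 + d) * (d * (1 + d))) \<le> norm d"
    using s by (simp add: yd)
  moreover have "(1 + d) * (d * (1 + d)) = (d + 2 *\<^sub>R (d * d)) + d * d * d"
    by (simp add: algebra_simps scaleR_2)
  ultimately have n1: "norm ((d + 2 *\<^sub>R (d * d)) + d * d * d) \<le> norm d" by simp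
  obtain k where k: "star k = k" "d = k * k"
    using d by (auto simp: hermitian_square_def)
  have dd: "hermitian_square (d * d)"
    using sd by (auto simp: hermitian_square_def)
  have ddd: "hermitian_square (d * d * d)"
    unfolding hermitian_square_def
    by (rule exI[of _ "k * k * k"]) (simp add: k star_simps mult.assoc)
  define N where "N = norm d"
  have dd2: "hermitian_square (d + 2 *\<^sub>R (d * d))"
    by (intro hermitian_square_add hermitian_square_scaleR d dd) auto
  have n2: "norm (d + 2 *\<^sub>R (d * d)) \<le> N"
    using hermitian_square_norm_mono[OF dd2 ddd] n1 by (simp add: N_def)
  \<comment> \<open>Completing the square: \<open>2 (f * f)\<close> is
    \<open>d + 2 (d * d) + 1/8\<close>. The bounds \<open>2 * (norm f)\<^sup>2 \<le> N + 1/8\<close>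
    and \<open>N + 1/4 \<le> norm f\<close> then leave only \<open>N = 0\<close>.\<close>
  define f where "f = d + (1/4) *\<^sub>R 1"
  have sf: "star f = f" by (simp add: f_def sd star_simps)
  have "hermitian_square (N *\<^sub>R 1 - (d + 2 *\<^sub>R (d * d)))"
    by (rule hermitian_square_norm_diff) (simp_all add: star_simps sd n2)
  moreover have "N *\<^sub>R 1 - (d + 2 *\<^sub>R (d * d)) = (N + 1/8) *\<^sub>R 1 - 2 *\<^sub>R (f * f)"
    by (simp add: f_def algebra_simps flip: scaleR_add_left)
  ultimately have "hermitian_square ((N + 1/8) *\<^sub>R 1 - 2 *\<^sub>R (f * f))" by simp
  then have "norm (2 *\<^sub>R (f * f)) \<le> N + 1/8"
    by (intro norm_le_of_hermitian_square_diff hermitian_square_scaleR)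
       (use sf in \<open>auto simp: hermitian_square_def N_def\<close>)
  then have n3: "2 * (norm f)\<^sup>2 \<le> N + 1/8"
    by (simp add: norm_hermitian_square[OF sf])
  have q: "hermitian_square ((1/4) *\<^sub>R (1 :: 'a))"
    unfolding hermitian_square_def by (rule exI[of _ "(1/2) *\<^sub>R 1"]) (simp add: star_simps)
  have nf: "1 / 4 \<le> norm f"
    using hermitian_square_norm_mono[OF q d] by (simp add: f_def add.commute)
  have "hermitian_square (norm f *\<^sub>R 1 - f)"
    by (rule hermitian_square_norm_diff[OF sf order_refl])
  then have "hermitian_square ((norm f - 1/4) *\<^sub>R 1 - d)"
    by (simp add: f_def algebra_simps)
  then have "norm d \<le> norm f - 1/4"
    using nf by (intro norm_le_of_hermitian_square_diff d) auto
  then have "(N + 1/4)\<^sup>2 \<le> (norm f)\<^sup>2"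
    by (intro power_mono) (auto simp: N_def)
  with n3 have "N\<^sup>2 \<le> 0"
    by (simp add: power2_eq_square algebra_simps)
  then have "d = 0" by (simp add: N_def)
  then show ?thesis
    using yd cstar_identity[of y] by simp
qed

text \<open>
  With \<open>b = x\<^sup>* x\<close> and \<open>r = \<bar>b\<bar>\<close>, the element \<open>m = r - b\<close> satisfies \<open>m\<^sup>2 = 2rm\<close>, hence \<open>m\<^sup>3\<close> is
  a positive square and \<open>(xm)\<^sup>* (xm) = - m\<^sup>3/2\<close>.
\<close>

lemma hermitian_square_star_mult: "hermitian_square (star x * x)"
proof -
  define b where "b = star x * x"
  have sb: "star b = b" by (simp add: b_def star_simps)
  have "hermitian_square (b * b)" using sb by (auto simp: hermitian_square_def)
  then obtain s0 where "star (b * b) = b * b" "norm (s0 *\<^sub>R 1 - b * b) \<le> s0"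
    by (auto simp: hermitian_square_iff_norm)
  from exists_hermitian_sqrt[OF this] obtain r s1 where r: "star r = r" "r * r = b * b"
     "norm (s1 *\<^sub>R 1 - r) \<le> s1" and comm_r: "\<And>w. w * (b * b) = b * b * w \<Longrightarrow> r * w = w * r"
    by metis
  \<comment> \<open>A root \<open>g\<close> of \<open>r\<close> lets half the cube of
    \<open>m\<close> be written as the single square of \<open>g * m\<close>.\<close>
  from exists_hermitian_sqrt[OF r(1,3)] obtain g where g: "star g = g" "g * g = r"
     and comm_g: "\<And>w. w * r = r * w \<Longrightarrow> g * w = w * g"
    by metis
  have rb: "r * b = b * r" by (rule comm_r) (simp add: mult.assoc)
  have gb: "g * b = b * g" by (rule comm_g) (simp add: rb)
  have gr: "g * r = r * g" by (rule comm_g) simp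
  define m where "m = r - b"
  have sm: "star m = m" by (simp add: m_def star_simps sb r)
  have gm: "g * m = m * g" by (simp add: m_def algebra_simps gb gr)
  have mm: "m * m = 2 *\<^sub>R (r * m)"
    by (simp add: m_def algebra_simps rb r(2) scaleR_2)
  have rm: "r * m = m * r" by (simp add: m_def algebra_simps rb)
  have bm: "b * m = - ((1/2) *\<^sub>R (m * m))"
  proof -
    have "b * m = r * m - m * m" by (simp add: m_def algebra_simps)
    also have "r * m = (1/2) *\<^sub>R (m * m)" by (simp add: mm)
    also have "(1/2) *\<^sub>R (m * m) - m * m = - ((1/2) *\<^sub>R (m * m))"
      using scaleR_add_left[of "1/2" "1/2" "m * m"] by (simp add: algebra_simps)
    finally show ?thesis .
  qed
  have mmm: "(1/2) *\<^sub>R (m * (m * m)) = (g * m) * (g * m)"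
  proof -
    have "m * (r * m) = (g * m) * (g * m)"
      by (metis g(2) gm mult.assoc)
    moreover have "m * (m * m) = 2 *\<^sub>R (m * (r * m))" by (simp add: mm)
    ultimately show ?thesis by simp
  qed
  define y where "y = x * m"
  have yy: "star y * y = - ((g * m) * (g * m))"
  proof -
    have "star y * y = m * (b * m)" by (simp add: y_def b_def star_simps sm mult.assoc)
    then show ?thesis by (simp add: bm mmm)
  qed
  have c: "hermitian_square ((g * m) * (g * m))"
    unfolding hermitian_square_def by (rule exI[of _ "g * m"]) (simp add: star_simps g sm gm)
  \<comment> \<open>Up to the factors 2 and -2, \<open>p\<close> and \<open>q\<close> are the real
    and imaginary parts of \<open>y\<close>. Their squares add up to twice
    \<open>y * star y + star y * y\<close>; since \<open>- (star y * y)\<close> is a square,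
    \<open>y * star y\<close> is positive.\<close>
  define p where "p = y + star y"
  define q where "q = \<i> *\<^sub>C (y - star y)"
  have "star p = p"
    by (simp add: p_def star_simps add.commute)
  moreover have "star q = q"
    by (simp add: q_def star_simps star_scaleC scaleC_minus_left scaleC_diff_right)
  ultimately have pq: "hermitian_square (p * p)" "hermitian_square (q * q)"
    by (auto simp: hermitian_square_def)
  have "q * q = - ((y - star y) * (y - star y))"
    by (simp add: q_def mult_scaleC_left mult_scaleC_right scaleC_i_i)
  then have "p * p + q * q = 2 *\<^sub>R (y * star y + star y * y)"
    by (simp add: p_def algebra_simps scaleR_2)
  then have "y * star y = (1/2) *\<^sub>R (p * p + q * q) + (g * m) * (g * m)"
    by (simp add: yy)
  then have "hermitian_square (y * star y)"
    using pq c by (simp only:) (intro hermitian_square_add hermitian_square_scaleR; simp)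
  from eq_0_if_star_mult_negative[OF c yy this] have "(g * m) * (g * m) = 0"
    using yy by simp
  then have "m * (m * m) = 0" using mmm by simp
  then have "(m * m) * (m * m) = 0" by (simp add: mult.assoc)
  then have "m = 0"
    using norm_hermitian_square[OF sm] norm_hermitian_square[of "m * m"] by (simp add: star_simps sm)
  then have "b = g * g" by (simp add: m_def g)
  then show ?thesis using g(1) by (auto simp: hermitian_square_def b_def)
qed

section \<open>Order calculus for \<open>cstar_positive\<close>\<close>

lemma cstar_positive_iff_hermitian_square: "cstar_positive x \<longleftrightarrow> hermitian_square x"
  unfolding cstar_positive_def
  by (metis hermitian_square_def hermitian_square_star_mult)

lemma cstar_positive_star_mult: "cstar_positive (star x * x)"
  by (auto simp: cstar_positive_def)

lemma cstar_positive_zero: "cstar_positive 0"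
  by (auto simp: cstar_positive_def intro!: exI[of _ 0])

lemmas cstar_positive_add = hermitian_square_add[folded cstar_positive_iff_hermitian_square]
lemmas cstar_positive_scaleR = hermitian_square_scaleR[folded cstar_positive_iff_hermitian_square]
lemmas cstar_positive_norm_mono =
  hermitian_square_norm_mono[folded cstar_positive_iff_hermitian_square]

lemma cstar_positive_sum:
  "(\<And>i. i \<in> I \<Longrightarrow> cstar_positive (f i)) \<Longrightarrow> cstar_positive (\<Sum>i\<in>I. f i)"
  by (induction I rule: infinite_finite_induct) (auto intro: cstar_positive_zero cstar_positive_add)

lemma cstar_positive_conj:
  assumes "cstar_positive x"
  shows "cstar_positive (star y * x * y)"
proof -
  obtain z where "x = star z * z" using assms by (auto simp: cstar_positive_def)
  then have "star y * x * y = star (z * y) * (z * y)" by (simp add: star_mult mult.assoc)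
  then show ?thesis by (simp add: cstar_positive_star_mult)
qed

lemma cstar_positive_norm_sq_diff:
  assumes "(norm x)\<^sup>2 \<le> r"
  shows "cstar_positive (r *\<^sub>R 1 - star x * x)"
  unfolding cstar_positive_iff_hermitian_square
  using assms by (intro hermitian_square_norm_diff) (simp_all add: star_simps cstar_identity)

text \<open>A Cauchy-Schwarz inequality: twice the difference is the sum of
  \<open>star (w k - w l) * (w k - w l)\<close> over all pairs.\<close>

lemma cstar_positive_sum_square_diff:
  fixes w :: "nat \<Rightarrow> 'a :: unital_cstar_algebra"
  shows "cstar_positive (real n *\<^sub>R (\<Sum>k<n. star (w k) * w k) - star (\<Sum>k<n. w k) * (\<Sum>k<n. w k))"
proof -
  let ?D = "real n *\<^sub>R (\<Sum>k<n. star (w k) * w k) - star (\<Sum>k<n. w k) * (\<Sum>k<n. w k)"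
  have "(\<Sum>k<n. \<Sum>l<n. star (w k - w l) * (w k - w l)) = 2 *\<^sub>R ?D"
  proof -
    have "(\<Sum>k<n. \<Sum>l<n. star (w k - w l) * (w k - w l)) =
       (\<Sum>k<n. \<Sum>l<n. star (w k) * w k) + (\<Sum>k<n. \<Sum>l<n. star (w l) * w l)
       - (\<Sum>k<n. \<Sum>l<n. star (w k) * w l) - (\<Sum>k<n. \<Sum>l<n. star (w l) * w k)"
      by (simp add: star_simps left_diff_distrib right_diff_distrib sum.distrib sum_subtractf
          algebra_simps del: sum_constant)
    moreover have "(\<Sum>k<n. \<Sum>l<n. star (w k) * w k) = real n *\<^sub>R (\<Sum>k<n. star (w k) * w k)"
      by (simp only: sum_constant_scaleR card_lessThan scaleR_sum_right)
    moreover have "(\<Sum>k<n. \<Sum>l<n. star (w l) * w l) = real n *\<^sub>R (\<Sum>k<n. star (w k) * w k)"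
      by (simp only: sum_constant_scaleR card_lessThan)
    moreover have "(\<Sum>k<n. \<Sum>l<n. star (w l) * w k) = (\<Sum>k<n. \<Sum>l<n. star (w k) * w l)"
      by (rule sum.swap)
    moreover have "(\<Sum>k<n. \<Sum>l<n. star (w k) * w l) = star (\<Sum>k<n. w k) * (\<Sum>k<n. w k)"
      by (simp add: star_sum sum_product)
    ultimately show ?thesis
      by (simp add: scaleR_2 algebra_simps del: scaleR_scaleR)
  qed
  moreover have "cstar_positive (\<Sum>k<n. \<Sum>l<n. star (w k - w l) * (w k - w l))"
    by (intro cstar_positive_sum cstar_positive_star_mult)
  ultimately have "cstar_positive (2 *\<^sub>R ?D)"
    by (simp only:)
  from cstar_positive_scaleR[OF this, of "1/2"] show ?thesis by simp
qed

section \<open>Conditional expectations with a quasi-basis\<close>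

locale cond_exp_basis =
  fixes P :: "'a :: unital_cstar_algebra set" and E :: "'a \<Rightarrow> 'a"
    and n :: nat and u v :: "nat \<Rightarrow> 'a"
  assumes subalgebra: "unital_cstar_subalgebra P"
    and expectation: "conditional_expectation P E"
    and basis: "quasi_basis E n u v"
begin

section \<open>Roots and inverses inside \<open>P\<close>\<close>

lemma P_one: "1 \<in> P"
  and P_add: "x \<in> P \<Longrightarrow> y \<in> P \<Longrightarrow> x + y \<in> P"
  and P_mult: "x \<in> P \<Longrightarrow> y \<in> P \<Longrightarrow> x * y \<in> P"
  and P_scaleC: "x \<in> P \<Longrightarrow> scaleC a x \<in> P"
  and P_star: "x \<in> P \<Longrightarrow> star x \<in> P"
  and P_closed: "closed P"
  using subalgebra by (auto simp: unital_cstar_subalgebra_def)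

lemma P_scaleR: "x \<in> P \<Longrightarrow> scaleR r x \<in> P"
  by (simp add: scaleR_eq_scaleC P_scaleC)

lemma P_zero: "0 \<in> P"
  using P_scaleR[OF P_one, of 0] by simp

lemma P_diff: "x \<in> P \<Longrightarrow> y \<in> P \<Longrightarrow> x - y \<in> P"
  using P_add[of x "(-1) *\<^sub>R y"] P_scaleR[of y "-1"] by simp

lemma P_sum: "(\<And>i. i \<in> I \<Longrightarrow> f i \<in> P) \<Longrightarrow> (\<Sum>i\<in>I. f i) \<in> P"
  by (induction I rule: infinite_finite_induct) (auto intro: P_zero P_add)

text \<open>The hermitian elements of \<open>P\<close> form a closed set stable under the
  square-root iteration for \<open>p\<close>.\<close>

lemma P_sqrt:
  assumes "p \<in> P" "star p = p" "norm p \<le> 1"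
  obtains r where "r \<in> P" "star r = r" "r * r = 1 - p"
proof -
  obtain y where y: "(1 - y) * (1 - y) = 1 - p"
    and S: "\<And>S. closed S \<Longrightarrow> 0 \<in> S \<Longrightarrow> (\<And>z. z \<in> S \<Longrightarrow> (1/2) *\<^sub>R (p + z * z) \<in> S) \<Longrightarrow> y \<in> S"
    using exists_sqrt_one_minus[OF assms(3)] by metis
  have "y \<in> P \<inter> {z. star z = z}"
    using assms by (intro S closed_Int P_closed closed_hermitian)
      (auto simp: P_zero star_simps intro!: P_scaleR P_add P_mult)
  then show ?thesis
    using that[of "1 - y"] y by (auto simp: star_simps intro!: P_diff P_one)
qed

text \<open>The inverse is the Neumann series, whose partial sums lie in the closed set
  \<open>P\<close>.\<close>

lemma P_invertible_near_1:
  assumes p: "p \<in> P" "norm (1 - p) < 1"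
  obtains q where "q \<in> P" "p * q = 1" "q * p = 1"
proof -
  define d where "d = 1 - p"
  have dP: "d ^ k \<in> P" for k
    by (induction k) (simp_all add: d_def P_one P_mult P_diff p)
  have d: "norm d < 1" using p by (simp add: d_def)
  then have "summable (\<lambda>k. d ^ k)"
    by (rule complete_algebra_summable_geometric)
  then have sums: "(\<lambda>m. \<Sum>k<m. d ^ k) \<longlonglongrightarrow> (\<Sum>k. d ^ k)"
    by (rule summable_LIMSEQ)
  have pd: "p = 1 - d" by (simp add: d_def)
  have fin: "p * (\<Sum>k<m. d ^ k) = 1 - d ^ m" "(\<Sum>k<m. d ^ k) * p = 1 - d ^ m" for m
    by (induction m) (simp_all add: distrib_left distrib_right pd left_diff_distrib
        right_diff_distrib power_commutes, simp add: algebra_simps)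
  have "(\<lambda>m. 1 - d ^ m) \<longlonglongrightarrow> 1 - 0"
    using d by (intro tendsto_intros LIMSEQ_power_zero) auto
  moreover have "(\<lambda>m. 1 - d ^ m) \<longlonglongrightarrow> p * (\<Sum>k. d ^ k)"
    unfolding fin(1)[symmetric] by (intro tendsto_intros sums)
  moreover have "(\<lambda>m. 1 - d ^ m) \<longlonglongrightarrow> (\<Sum>k. d ^ k) * p"
    unfolding fin(2)[symmetric] by (intro tendsto_intros sums)
  ultimately have "p * (\<Sum>k. d ^ k) = 1" "(\<Sum>k. d ^ k) * p = 1"
    using LIMSEQ_unique by fastforce+
  moreover have "(\<Sum>k. d ^ k) \<in> P"
    using closed_sequentially[OF P_closed _ sums] dP by (simp add: P_sum)
  ultimately show ?thesis using that by blast
qed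

text \<open>Both \<open>p * q\<close> and \<open>q * p\<close> are invertible in \<open>P\<close>,
  so \<open>p\<close> has a right and a left inverse there, and these agree.\<close>

lemma P_invertible_if_almost:
  assumes p: "p \<in> P" and q: "q \<in> P" and "norm (p * q - 1) < 1" "norm (q * p - 1) < 1"
  shows "p \<in> invertibles_of P"
proof -
  have "norm (1 - p * q) < 1" "norm (1 - q * p) < 1"
    using assms by (simp_all add: norm_minus_commute)
  then obtain r s where r: "r \<in> P" "(p * q) * r = 1" and s: "s \<in> P" "s * (q * p) = 1"
    using P_invertible_near_1 P_mult[OF p q] P_mult[OF q p] by metis
  have "s * q = s * q * (p * q * r)" by (simp add: r)
  also have "\<dots> = s * (q * p) * (q * r)" by (simp add: mult.assoc)
  finally have "s * q = q * r" by (simp add: s)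
  then have "p * (q * r) = 1" "(q * r) * p = 1"
    using r s by (simp_all add: mult.assoc) (metis mult.assoc)
  then show ?thesis
    unfolding invertibles_of_def using p q r P_mult by blast
qed

section \<open>Adjoints, the quasi-basis and the index\<close>

lemma E_in: "E x \<in> P"
  and E_id: "p \<in> P \<Longrightarrow> E p = p"
  and E_add: "E (x + y) = E x + E y"
  and E_scaleC: "E (scaleC a x) = scaleC a (E x)"
  and E_mult_left: "p \<in> P \<Longrightarrow> E (p * x) = p * E x"
  and E_mult_right: "p \<in> P \<Longrightarrow> E (x * p) = E x * p"
  and E_positive: "cstar_positive x \<Longrightarrow> cstar_positive (E x)"
  and norm_E_le: "norm (E x) \<le> norm x"
  using expectation by (auto simp: conditional_expectation_def)

lemmas E_diff = conditional_expectation_diff[OF expectation]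

lemma E_scaleR: "E (scaleR r x) = scaleR r (E x)"
  by (simp add: scaleR_eq_scaleC E_scaleC)

lemma E_zero: "E 0 = 0"
  using E_diff[of 0 0] by simp

lemma E_sum: "E (\<Sum>i\<in>I. f i) = (\<Sum>i\<in>I. E (f i))"
  by (induction I rule: infinite_finite_induct) (auto simp: E_zero E_add)

text \<open>Positivity of \<open>E\<close> makes \<open>E (y * y)\<close> hermitian for hermitian
  \<open>y\<close>. A hermitian \<open>h\<close> is a quarter of the difference of the squares of
  \<open>1 + h\<close> and \<open>1 - h\<close>; real and imaginary parts give the rest.\<close>

lemma E_star: "E (star x) = star (E x)"
proof -
  have herm: "star (E h) = E h" if "star h = h" for h
  proof -
    have *: "star (E (y * y)) = E (y * y)" if "star y = y" for y
      using E_positive[OF cstar_positive_star_mult[of y]] that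
      by (auto simp: cstar_positive_def star_simps)
    have "h = (1/4) *\<^sub>R ((1 + h) * (1 + h)) - (1/4) *\<^sub>R ((1 - h) * (1 - h))"
      by (simp add: algebra_simps flip: scaleR_add_left)
    then have "E h = (1/4) *\<^sub>R E ((1 + h) * (1 + h)) - (1/4) *\<^sub>R E ((1 - h) * (1 - h))"
      using E_diff E_scaleR by metis
    then show ?thesis
      using *[of "1 + h"] *[of "1 - h"] that by (simp add: star_simps)
  qed
  define a where "a = x + star x"
  define b where "b = scaleC \<i> (x - star x)"
  have "star a = a"
    by (simp add: a_def star_simps add.commute)
  moreover have "star b = b"
    by (simp add: b_def star_simps star_scaleC scaleC_minus_left scaleC_diff_right)
  ultimately have h: "star (E a) = E a" "star (E b) = E b"
    using herm by auto
  have "star (E x) + star (E (star x)) = E x + E (star x)"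
    using h(1) by (simp add: a_def star_simps E_add add.commute)
  moreover have "\<i> *\<^sub>C (star (E (star x)) - star (E x)) = \<i> *\<^sub>C (E x - E (star x))"
    using h(2) by (simp add: b_def star_simps star_scaleC scaleC_minus_left E_scaleC E_diff scaleC_diff_right)
  then have "star (E (star x)) - star (E x) = E x - E (star x)"
    using scaleC_i_i by (metis neg_equal_iff_equal)
  ultimately have "2 *\<^sub>R star (E x) = 2 *\<^sub>R E (star x)"
    unfolding scaleR_2 by (smt (verit) add.assoc add.commute add_right_cancel diff_add_cancel)
  then show ?thesis by simp
qed

lemma basis_left: "(\<Sum>i<n. u i * E (v i * a)) = a"
  and basis_right: "(\<Sum>i<n. E (a * u i) * v i) = a"
  using basis by (auto simp: quasi_basis_def)

text \<open>Taking adjoints exchanges the two quasi-basis expansions, since \<open>E\<close>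
  preserves adjoints.\<close>

lemma basis_star: "quasi_basis E n (\<lambda>i. star (v i)) (\<lambda>i. star (u i))"
  unfolding quasi_basis_def
proof (intro allI conjI)
  fix a
  show "a = (\<Sum>i<n. star (v i) * E (star (u i) * a))"
    using arg_cong[OF basis_right[of "star a"], of star]
    by (simp add: star_sum star_simps flip: E_star)
  show "a = (\<Sum>i<n. E (a * star (v i)) * star (u i))"
    using arg_cong[OF basis_left[of "star a"], of star]
    by (simp add: star_sum star_simps flip: E_star)
qed

lemma basis_star_right: "(\<Sum>i<n. E (a * star (v i)) * star (u i)) = a"
  using basis_star by (auto simp: quasi_basis_def)

definition index :: 'a where
  "index = (\<Sum>i<n. u i * v i)"

lemma star_index: "star index = index"
  using quasi_basis_sum_unique[OF basis_star basis] by (simp add: index_def star_sum star_simps)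

text \<open>Expanding \<open>v i * a\<close> by \<open>basis_right\<close> and interchanging the
  sums leaves an expansion of \<open>a * u j\<close> by \<open>basis_left\<close>.\<close>

lemma index_central: "index * a = a * index"
proof -
  have "index * a = (\<Sum>i<n. u i * (\<Sum>j<n. E (v i * a * u j) * v j))"
    by (simp only: basis_right) (simp add: index_def sum_distrib_right mult.assoc)
  also have "\<dots> = (\<Sum>j<n. (\<Sum>i<n. u i * E (v i * (a * u j))) * v j)"
    by (simp add: sum_distrib_left sum_distrib_right mult.assoc) (rule sum.swap)
  also have "\<dots> = a * index"
    by (simp only: basis_left) (simp add: index_def sum_distrib_left mult.assoc)
  finally show ?thesis .
qed

section \<open>The frame operator and its Richardson iteration\<close>

text \<open>
  In terms of the basic construction, \<open>frame\<close> is \<open>\<Sum>\<^sub>k v\<^sub>k\<^sup>* e\<^sub>P v\<^sub>k\<close>, and \<open>relax\<close> is a Richardson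
  iteration step for it.
\<close>

definition frame :: "'a \<Rightarrow> 'a" where
  "frame a = (\<Sum>k<n. star (v k) * E (v k * a))"

text \<open>The factor \<open>n\<close> comes from Cauchy-Schwarz over \<open>n\<close> summands,
  and the \<open>1\<close> keeps the value positive. Including both \<open>u\<close> and
  \<open>v\<close> makes one constant serve the upper and the lower frame estimate.\<close>

definition frame_bound :: real where
  "frame_bound = 1 + real n * (\<Sum>k<n. (norm (u k))\<^sup>2 + (norm (v k))\<^sup>2)"

definition relax :: "'a \<Rightarrow> 'a" where
  "relax a = a - (1 / frame_bound) *\<^sub>R frame a"

text \<open>The quadratic form of \<open>frame\<close> for the \<open>P\<close>-valued inner product
  \<open>E (star x * y)\<close>.\<close>

definition energy :: "'a \<Rightarrow> 'a" where
  "energy a = (\<Sum>k<n. star (E (v k * a)) * E (v k * a))"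

lemma frame_bound_ge_1: "1 \<le> frame_bound"
  by (simp add: frame_bound_def sum_nonneg)

lemma norm_basis_le_frame_bound:
  assumes "k < n"
  shows "real n * (norm (u k))\<^sup>2 \<le> frame_bound" "real n * (norm (v k))\<^sup>2 \<le> frame_bound"
proof -
  have "(norm (u k))\<^sup>2 + (norm (v k))\<^sup>2 \<le> (\<Sum>k<n. (norm (u k))\<^sup>2 + (norm (v k))\<^sup>2)"
    using assms by (intro member_le_sum) auto
  then have "(norm (u k))\<^sup>2 \<le> (\<Sum>k<n. (norm (u k))\<^sup>2 + (norm (v k))\<^sup>2)"
    "(norm (v k))\<^sup>2 \<le> (\<Sum>k<n. (norm (u k))\<^sup>2 + (norm (v k))\<^sup>2)"
    by (smt (verit) zero_le_power2)+
  then have "real n * (norm (u k))\<^sup>2 \<le> real n * (\<Sum>k<n. (norm (u k))\<^sup>2 + (norm (v k))\<^sup>2)"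
    "real n * (norm (v k))\<^sup>2 \<le> real n * (\<Sum>k<n. (norm (u k))\<^sup>2 + (norm (v k))\<^sup>2)"
    by (simp_all add: mult_left_mono)
  then show "real n * (norm (u k))\<^sup>2 \<le> frame_bound" "real n * (norm (v k))\<^sup>2 \<le> frame_bound"
    by (simp_all add: frame_bound_def)
qed

lemma energy_in_P: "energy a \<in> P"
  unfolding energy_def by (intro P_sum P_mult P_star E_in)

lemma energy_positive: "cstar_positive (energy a)"
  unfolding energy_def by (intro cstar_positive_sum cstar_positive_star_mult)

text \<open>Two choices of \<open>w\<close> matter: \<open>star (v k)\<close> makes \<open>b\<close>
  equal to \<open>frame a\<close>, and \<open>u k\<close> makes it \<open>a\<close>. Cauchy-Schwarz
  reduces the claim to bounding \<open>star (w k) * w k\<close> by the squared norm of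
  \<open>w k\<close>.\<close>

lemma sum_coefficients_le_energy:
  fixes w :: "nat \<Rightarrow> 'a" and a :: 'a
  assumes "\<And>k. k < n \<Longrightarrow> real n * (norm (w k))\<^sup>2 \<le> frame_bound"
  defines "b \<equiv> \<Sum>k<n. w k * E (v k * a)"
  shows "cstar_positive (frame_bound *\<^sub>R energy a - star b * b)"
proof -
  let ?z = "\<lambda>k. w k * E (v k * a)"
  have "cstar_positive (frame_bound *\<^sub>R energy a - real n *\<^sub>R (\<Sum>k<n. star (?z k) * ?z k))"
  proof -
    have "frame_bound *\<^sub>R energy a - real n *\<^sub>R (\<Sum>k<n. star (?z k) * ?z k) =
        (\<Sum>k<n. star (E (v k * a)) * (frame_bound *\<^sub>R 1 - real n *\<^sub>R (star (w k) * w k)) * E (v k * a))"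
      unfolding energy_def scaleR_sum_right sum_subtractf[symmetric]
      by (intro sum.cong refl) (simp add: star_mult left_diff_distrib right_diff_distrib mult.assoc)
    also have "cstar_positive \<dots>"
    proof (intro cstar_positive_sum cstar_positive_conj)
      fix k assume "k \<in> {..<n}"
      then have "cstar_positive (frame_bound *\<^sub>R 1 - star (sqrt n *\<^sub>R w k) * (sqrt n *\<^sub>R w k))"
        using assms(1) by (intro cstar_positive_norm_sq_diff) (simp add: power_mult_distrib)
      then show "cstar_positive (frame_bound *\<^sub>R 1 - real n *\<^sub>R (star (w k) * w k))"
        by (simp add: star_simps)
    qed
    finally show ?thesis .
  qed
  from cstar_positive_add[OF this cstar_positive_sum_square_diff[of n ?z]]
  show ?thesis by (simp add: b_def)
qed

lemma frame_inner: "E (star x * frame y) = (\<Sum>k<n. star (E (v k * x)) * E (v k * y))"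
  by (simp add: frame_def sum_distrib_left E_sum E_mult_right E_in star_simps
      flip: E_star mult.assoc)

lemma frame_self_adjoint: "E (star (frame x) * y) = E (star x * frame y)"
proof -
  have "E (star (frame x) * y) = star (E (star y * frame x))"
    by (simp add: star_simps flip: E_star)
  then show ?thesis
    by (simp add: frame_inner star_sum star_simps)
qed

lemma relax_self_adjoint: "E (star (relax x) * y) = E (star x * relax y)"
  by (simp add: relax_def star_simps algebra_simps E_diff E_scaleR frame_self_adjoint)

lemma relax_power_self_adjoint: "E (star ((relax ^^ m) x) * y) = E (star x * (relax ^^ m) y)"
  by (induction m arbitrary: y) (simp_all add: relax_self_adjoint, simp add: funpow_swap1)

lemma frame_module: "p \<in> P \<Longrightarrow> frame (a * p) = frame a * p"
  by (simp add: frame_def sum_distrib_right E_mult_right flip: mult.assoc)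

lemma frame_add: "frame (a + b) = frame a + frame b"
  by (simp add: frame_def distrib_left E_add sum.distrib)

lemma frame_diff: "frame (a - b) = frame a - frame b"
  using frame_add[of "a - b" b] by simp

lemma frame_scaleR: "frame (r *\<^sub>R a) = r *\<^sub>R frame a"
  by (simp add: frame_def E_scaleR scaleR_sum_right)

lemma relax_module: "p \<in> P \<Longrightarrow> relax (a * p) = relax a * p"
  by (simp add: relax_def frame_module algebra_simps)

lemma relax_add: "relax (a + b) = relax a + relax b"
  by (simp add: relax_def frame_add algebra_simps)

lemma relax_scaleR: "relax (r *\<^sub>R a) = r *\<^sub>R relax a"
  by (simp add: relax_def frame_scaleR algebra_simps)

lemma relax_power_module: "p \<in> P \<Longrightarrow> (relax ^^ m) (a * p) = (relax ^^ m) a * p"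
  by (induction m) (simp_all add: relax_module)

lemma relax_power_add: "(relax ^^ m) (a + b) = (relax ^^ m) a + (relax ^^ m) b"
  by (induction m) (simp_all add: relax_add)

lemma relax_power_scaleR: "(relax ^^ m) (r *\<^sub>R a) = r *\<^sub>R (relax ^^ m) a"
  by (induction m) (simp_all add: relax_scaleR)

lemma relax_power_sum: "(relax ^^ m) (\<Sum>i\<in>I. f i) = (\<Sum>i\<in>I. (relax ^^ m) (f i))"
  using relax_power_scaleR[of m 0 0]
  by (induction I rule: infinite_finite_induct) (auto simp: relax_power_add)

lemma relax_power_diff: "(relax ^^ m) (a - b) = (relax ^^ m) a - (relax ^^ m) b"
  using relax_power_add[of m "a - b" b] by simp

text \<open>With \<open>t = 1 / frame_bound\<close>, expanding the square gives a loss of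
  \<open>2 * t\<close> times the energy and a gain of \<open>t * t\<close> times
  \<open>E (star (frame a) * frame a)\<close>, which the upper frame estimate bounds by
  \<open>t\<close> times the energy.\<close>

lemma relax_energy:
  "cstar_positive (E (star a * a) - E (star (relax a) * relax a) - (1 / frame_bound) *\<^sub>R energy a)"
proof -
  define t where "t = 1 / frame_bound"
  have t: "t > 0" "t * t * frame_bound = t"
    using frame_bound_ge_1 by (auto simp: t_def)
  have en: "E (star a * frame a) = energy a" "E (star (frame a) * a) = energy a"
    by (simp_all add: frame_self_adjoint frame_inner energy_def)
  have "E (star (relax a) * relax a) =
      E (star a * a) - (t *\<^sub>R energy a + t *\<^sub>R energy a) + (t * t) *\<^sub>R E (star (frame a) * frame a)"
    unfolding relax_def t_def[symmetric]
    by (simp add: star_simps algebra_simps E_diff E_add E_scaleR en)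
  moreover have "t *\<^sub>R energy a = (t * t) *\<^sub>R (frame_bound *\<^sub>R energy a)"
    using t(2) by simp
  ultimately have "E (star a * a) - E (star (relax a) * relax a) - t *\<^sub>R energy a =
     (t * t) *\<^sub>R E (frame_bound *\<^sub>R energy a - star (frame a) * frame a)"
    by (simp add: E_diff E_scaleR E_id[OF energy_in_P] scaleR_diff_right)
  also have "cstar_positive \<dots>"
    unfolding frame_def using t(1) norm_basis_le_frame_bound(2)
    by (intro cstar_positive_scaleR E_positive sum_coefficients_le_energy) (auto simp: norm_star)
  finally show ?thesis by (simp add: t_def)
qed

lemma square_le_energy: "cstar_positive (frame_bound *\<^sub>R energy a - star a * a)"
  using sum_coefficients_le_energy[of u a] norm_basis_le_frame_bound(1)
  by (simp add: basis_left)

text \<open>A Pimsner-Popa type inequality: \<open>star a * a\<close> is controlled by the energy,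
  and the energy by \<open>E (star a * a)\<close> because the relaxed term in
  \<open>relax_energy\<close> is positive. It makes \<open>E\<close> faithful with a uniform
  constant.\<close>

lemma norm_le_expectation:
  "(norm a)\<^sup>2 \<le> frame_bound\<^sup>2 * norm (E (star a * a))"
proof -
  have N: "frame_bound > 0" using frame_bound_ge_1 by simp
  have "(norm a)\<^sup>2 \<le> norm (frame_bound *\<^sub>R energy a)"
    using cstar_positive_norm_mono[OF cstar_positive_star_mult square_le_energy, of a a]
    by (simp add: cstar_identity)
  then have 1: "(norm a)\<^sup>2 \<le> frame_bound * norm (energy a)"
    using N by simp
  have "norm ((1 / frame_bound) *\<^sub>R energy a) \<le> norm ((1 / frame_bound) *\<^sub>R energy a +
     (E (star (relax a) * relax a) + (E (star a * a) - E (star (relax a) * relax a) - (1 / frame_bound) *\<^sub>R energy a)))"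
    using N by (intro cstar_positive_norm_mono cstar_positive_scaleR energy_positive
        cstar_positive_add relax_energy E_positive cstar_positive_star_mult) auto
  then have "norm (energy a) / frame_bound \<le> norm (E (star a * a))"
    using N by (simp add: field_simps)
  then have "norm (energy a) \<le> frame_bound * norm (E (star a * a))"
    using N by (simp add: field_simps)
  then have "frame_bound * norm (energy a) \<le> frame_bound * (frame_bound * norm (E (star a * a)))"
    using N by simp
  with 1 show ?thesis by (simp add: power2_eq_square)
qed

text \<open>By \<open>square_le_energy\<close>, the energy lost in \<open>relax_energy\<close>
  yields a fixed fraction of \<open>E (star a * a)\<close>.\<close>

lemma norm_relax_le:
  "norm (E (star (relax a) * relax a)) \<le> (1 - 1 / frame_bound\<^sup>2) * norm (E (star a * a))"
proof -
  define t where "t = 1 / frame_bound"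
  have t: "0 < t" "t \<le> 1" "t * t * frame_bound = t"
    using frame_bound_ge_1 by (auto simp: t_def)
  have "t *\<^sub>R energy a = (t * t) *\<^sub>R (frame_bound *\<^sub>R energy a)"
    using t(3) by simp
  then have eq: "(1 - t * t) *\<^sub>R E (star a * a) - E (star (relax a) * relax a) =
     (E (star a * a) - E (star (relax a) * relax a) - t *\<^sub>R energy a) +
     (t * t) *\<^sub>R E (frame_bound *\<^sub>R energy a - star a * a)"
    by (simp add: E_diff E_scaleR E_id[OF energy_in_P] algebra_simps)
  have "cstar_positive ((1 - t * t) *\<^sub>R E (star a * a) - E (star (relax a) * relax a))"
    unfolding eq using t relax_energy[of a, folded t_def]
    by (intro cstar_positive_add cstar_positive_scaleR E_positive square_le_energy) auto
  from cstar_positive_norm_mono[OF E_positive[OF cstar_positive_star_mult] this, of "relax a"]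
  have "norm (E (star (relax a) * relax a)) \<le> norm ((1 - t * t) *\<^sub>R E (star a * a))"
    by simp
  moreover have "t * t \<le> 1 * 1" using t by (intro mult_mono) auto
  ultimately show ?thesis by (simp add: t_def power2_eq_square)
qed

text \<open>Geometric decay in the \<open>P\<close>-valued inner product passes to the norm by
  \<open>norm_le_expectation\<close>.\<close>

lemma relax_power_tendsto_0: "(\<lambda>m. (relax ^^ m) a) \<longlonglongrightarrow> 0"
proof -
  define q where "q = 1 - 1 / frame_bound\<^sup>2"
  have q: "0 \<le> q" "q < 1"
    using frame_bound_ge_1 power_mono[of 1 frame_bound 2] by (auto simp: q_def)
  define x where "x m = (relax ^^ m) a" for m
  have "norm (E (star (x m) * x m)) \<le> q ^ m * norm (E (star a * a))" for m
  proof (induction m)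
    case (Suc m)
    have "norm (E (star (x (Suc m)) * x (Suc m))) \<le> q * norm (E (star (x m) * x m))"
      using norm_relax_le[of "x m"] by (simp add: x_def q_def)
    also have "\<dots> \<le> q * (q ^ m * norm (E (star a * a)))"
      using Suc q by (intro mult_left_mono) auto
    finally show ?case by (simp add: mult.assoc)
  qed (simp add: x_def)
  then have "(norm (x m))\<^sup>2 \<le> frame_bound\<^sup>2 * (q ^ m * norm (E (star a * a)))" for m
    by (meson norm_le_expectation mult_left_mono order_trans zero_le_power2)
  then have "\<forall>\<^sub>F m in sequentially. norm ((norm (x m))\<^sup>2) \<le> frame_bound\<^sup>2 * (q ^ m * norm (E (star a * a)))"
    by simp
  moreover have "(\<lambda>m. frame_bound\<^sup>2 * (q ^ m * norm (E (star a * a)))) \<longlonglongrightarrow> 0"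
    using q by (intro tendsto_mult_right_zero tendsto_mult_left_zero LIMSEQ_power_zero) auto
  ultimately have "(\<lambda>m. (norm (x m))\<^sup>2) \<longlonglongrightarrow> 0"
    by (rule Lim_null_comparison)
  from tendsto_real_sqrt[OF this] have "(\<lambda>m. norm (x m)) \<longlonglongrightarrow> 0"
    by simp
  then show ?thesis
    by (simp add: tendsto_norm_zero_iff x_def)
qed

end

section \<open>Positivity in the sequence algebra\<close>

lemma seq_rel_refl_iff: "seq_rel f f \<longleftrightarrow> Bseq f"
  by (auto simp: seq_rel_def)

lemma seq_alg_cases:
  obtains f where "Bseq f" "x = abs_seq_alg f"
  using Quotient3_abs_rep[OF Quotient3_seq_alg, of x]
    Quotient3_rep_reflp[OF Quotient3_seq_alg, of x] by (metis seq_rel_refl_iff)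

lemma abs_seq_alg_eq_iff:
  assumes "Bseq f" "Bseq g"
  shows "abs_seq_alg f = abs_seq_alg g \<longleftrightarrow> (\<lambda>n. f n - g n) \<longlonglongrightarrow> 0"
  using Quotient3_rel[OF Quotient3_seq_alg, of f g] assms by (auto simp: seq_rel_def)

lemma Bseq_closed:
  fixes f g :: "nat \<Rightarrow> 'a :: unital_cstar_algebra"
  assumes "Bseq f"
  shows Bseq_add': "Bseq g \<Longrightarrow> Bseq (\<lambda>n. f n + g n)"
    and Bseq_diff': "Bseq g \<Longrightarrow> Bseq (\<lambda>n. f n - g n)"
    and Bseq_mult': "Bseq g \<Longrightarrow> Bseq (\<lambda>n. f n * g n)"
    and Bseq_star: "Bseq (\<lambda>n. star (f n))"
    and Bseq_scaleR': "Bseq (\<lambda>n. r *\<^sub>R f n)"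
  using assms seq_rel_add[of f f g g] seq_rel_diff[of f f g g] seq_rel_mult[of f f g g]
    seq_rel_star[of f f] seq_rel_scaleR[of f f r] by (simp_all add: seq_rel_refl_iff)

lemma abs_seq_alg_ops:
  fixes f g :: "nat \<Rightarrow> 'a :: unital_cstar_algebra"
  assumes "Bseq f"
  shows abs_seq_alg_add: "Bseq g \<Longrightarrow> abs_seq_alg f + abs_seq_alg g = abs_seq_alg (\<lambda>n. f n + g n)"
    and abs_seq_alg_diff: "Bseq g \<Longrightarrow> abs_seq_alg f - abs_seq_alg g = abs_seq_alg (\<lambda>n. f n - g n)"
    and abs_seq_alg_mult: "Bseq g \<Longrightarrow> abs_seq_alg f * abs_seq_alg g = abs_seq_alg (\<lambda>n. f n * g n)"
    and abs_seq_alg_star: "star (abs_seq_alg f) = abs_seq_alg (\<lambda>n. star (f n))"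
    and abs_seq_alg_scaleR: "r *\<^sub>R abs_seq_alg f = abs_seq_alg (\<lambda>n. r *\<^sub>R f n)"
  using assms
  by (simp_all add: plus_seq_alg.abs_eq minus_seq_alg.abs_eq times_seq_alg.abs_eq
      star_seq_alg.abs_eq scaleR_seq_alg.abs_eq seq_rel_refl_iff)

lemma const_seq_abs: "const_seq a = abs_seq_alg (\<lambda>_. a)"
  by (simp add: const_seq.abs_eq)

lemma zero_seq_alg_abs: "0 = abs_seq_alg (\<lambda>_. 0)"
  by (simp add: zero_seq_alg.abs_eq)

lemma
  fixes a b :: "'a :: unital_cstar_algebra"
  shows const_seq_add: "const_seq (a + b) = const_seq a + const_seq b"
    and const_seq_mult: "const_seq (a * b) = const_seq a * const_seq b"
    and const_seq_star: "const_seq (star a) = star (const_seq a)"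
    and const_seq_scaleR: "const_seq (r *\<^sub>R a) = r *\<^sub>R const_seq a"
    and const_seq_zero: "const_seq (0 :: 'a) = 0"
    and const_seq_one: "const_seq (1 :: 'a) = 1"
  by (simp_all add: const_seq_abs abs_seq_alg_ops Bfun_const zero_seq_alg_abs one_seq_alg.abs_eq)

lemma const_seq_sum: "const_seq (\<Sum>i\<in>I. f i) = (\<Sum>i\<in>I. const_seq (f i :: 'a :: unital_cstar_algebra))"
  by (induction I rule: infinite_finite_induct) (auto simp: const_seq_zero const_seq_add)

text \<open>Encoded through a representative so that order estimates can be checked termwise in the
  original algebra.\<close>

definition seq_positive :: "'a :: unital_cstar_algebra seq_alg \<Rightarrow> bool" where
  "seq_positive x \<longleftrightarrow> (\<exists>f. Bseq f \<and> (\<forall>n. cstar_positive (f n)) \<and> x = abs_seq_alg f)"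

text \<open>Stands in for a bound on the quotient norm; being termwise, it passes directly through
  sums, products and the induced expectation.\<close>

definition seq_bounded_by :: "real \<Rightarrow> 'a :: unital_cstar_algebra seq_alg \<Rightarrow> bool" where
  "seq_bounded_by r x \<longleftrightarrow> (\<exists>f. (\<forall>n. norm (f n) \<le> r) \<and> x = abs_seq_alg f)"

lemma seq_positive_star_mult: "seq_positive (star x * x)"
proof -
  obtain f where f: "Bseq f" "x = abs_seq_alg f" by (rule seq_alg_cases)
  then show ?thesis
    unfolding seq_positive_def
    by (intro exI[of _ "\<lambda>n. star (f n) * f n"])
       (auto simp: abs_seq_alg_ops Bseq_closed cstar_positive_star_mult)
qed

lemma seq_positive_zero: "seq_positive 0"
  using seq_positive_star_mult[of 0] by simp

lemma seq_positive_add: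
  assumes "seq_positive x" "seq_positive y"
  shows "seq_positive (x + y)"
proof -
  obtain f g where "Bseq f" "Bseq g" "\<And>n. cstar_positive (f n)" "\<And>n. cstar_positive (g n)"
    "x = abs_seq_alg f" "y = abs_seq_alg g"
    using assms by (auto simp: seq_positive_def)
  then show ?thesis
    unfolding seq_positive_def
    by (intro exI[of _ "\<lambda>n. f n + g n"]) (auto simp: abs_seq_alg_ops Bseq_closed cstar_positive_add)
qed

lemma seq_positive_scaleR:
  assumes "seq_positive x" "0 \<le> r"
  shows "seq_positive (r *\<^sub>R x)"
proof -
  obtain f where "Bseq f" "\<And>n. cstar_positive (f n)" "x = abs_seq_alg f"
    using assms by (auto simp: seq_positive_def)
  then show ?thesis
    unfolding seq_positive_def using assms(2)
    by (intro exI[of _ "\<lambda>n. r *\<^sub>R f n"]) (auto simp: abs_seq_alg_ops Bseq_closed cstar_positive_scaleR)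
qed

lemma seq_positive_sum:
  "(\<And>i. i \<in> I \<Longrightarrow> seq_positive (f i)) \<Longrightarrow> seq_positive (\<Sum>i\<in>I. f i)"
  by (induction I rule: infinite_finite_induct) (auto intro: seq_positive_zero seq_positive_add)

lemma seq_bounded_by_zero: "seq_bounded_by 0 0"
  unfolding seq_bounded_by_def by (intro exI[of _ "\<lambda>_. 0"]) (simp add: zero_seq_alg_abs)

lemma seq_bounded_by_mono: "seq_bounded_by r x \<Longrightarrow> r \<le> s \<Longrightarrow> seq_bounded_by s x"
  unfolding seq_bounded_by_def by (metis order_trans)

lemma seq_bounded_by_add:
  assumes "seq_bounded_by r x" "seq_bounded_by s y"
  shows "seq_bounded_by (r + s) (x + y)"
proof -
  obtain f g where fg: "\<And>n. norm (f n) \<le> r" "\<And>n. norm (g n) \<le> s"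
    "x = abs_seq_alg f" "y = abs_seq_alg g"
    using assms by (auto simp: seq_bounded_by_def)
  have "x + y = abs_seq_alg (\<lambda>n. f n + g n)"
    unfolding fg(3,4) by (rule abs_seq_alg_add[OF BseqI'[OF fg(1)] BseqI'[OF fg(2)]])
  with fg show ?thesis
    unfolding seq_bounded_by_def
    by (intro exI[of _ "\<lambda>n. f n + g n"] conjI allI norm_triangle_mono)
qed

lemma seq_bounded_by_uminus:
  assumes "seq_bounded_by r x"
  shows "seq_bounded_by r (- x)"
proof -
  obtain f where fg: "\<And>n. norm (f n) \<le> r" "x = abs_seq_alg f"
    using assms by (auto simp: seq_bounded_by_def)
  then have "- x = abs_seq_alg (\<lambda>n. (-1) *\<^sub>R f n)"
    using abs_seq_alg_scaleR[OF BseqI'[OF fg(1)], of "-1"] by simp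
  with fg(1) show ?thesis
    unfolding seq_bounded_by_def by (intro exI[of _ "\<lambda>n. (-1) *\<^sub>R f n"]) auto
qed

lemma seq_bounded_by_sum:
  "(\<And>i. i \<in> I \<Longrightarrow> seq_bounded_by (r i) (f i)) \<Longrightarrow> seq_bounded_by (\<Sum>i\<in>I. r i) (\<Sum>i\<in>I. f i)"
  by (induction I rule: infinite_finite_induct) (auto intro: seq_bounded_by_zero seq_bounded_by_add)

lemma seq_bounded_by_mult:
  assumes "seq_bounded_by r x" "seq_bounded_by s y"
  shows "seq_bounded_by (r * s) (x * y)"
proof -
  obtain f g where fg: "\<And>n. norm (f n) \<le> r" "\<And>n. norm (g n) \<le> s"
    "x = abs_seq_alg f" "y = abs_seq_alg g"
    using assms by (auto simp: seq_bounded_by_def)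
  have "x * y = abs_seq_alg (\<lambda>n. f n * g n)"
    unfolding fg(3,4) by (rule abs_seq_alg_mult[OF BseqI'[OF fg(1)] BseqI'[OF fg(2)]])
  moreover have "norm (f n * g n) \<le> r * s" for n
    using norm_mult_ineq[of "f n" "g n"] mult_mono'[OF fg(1)[of n] fg(2)[of n]] by simp
  ultimately show ?thesis
    unfolding seq_bounded_by_def by (intro exI[of _ "\<lambda>n. f n * g n"]) auto
qed

lemma seq_bounded_by_star:
  assumes "seq_bounded_by r x"
  shows "seq_bounded_by r (star x)"
proof -
  obtain f where f: "\<And>n. norm (f n) \<le> r" "x = abs_seq_alg f"
    using assms by (auto simp: seq_bounded_by_def)
  then show ?thesis
    using abs_seq_alg_star[OF BseqI'[OF f(1)]]
    unfolding seq_bounded_by_def by (intro exI[of _ "\<lambda>n. star (f n)"]) (simp add: norm_star)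
qed

lemma seq_bounded_by_const: "seq_bounded_by (norm a) (const_seq a)"
  unfolding seq_bounded_by_def const_seq_abs by auto

lemma seq_bounded_by_exists:
  obtains r where "0 \<le> r" "seq_bounded_by r x"
proof -
  obtain f where "Bseq f" "x = abs_seq_alg f" by (rule seq_alg_cases)
  then show ?thesis
    using that unfolding Bseq_def seq_bounded_by_def by (metis less_imp_le)
qed

text \<open>Here \<open>x\<close> lies below \<open>x + y\<close>, which can be made arbitrarily
  small; norm monotonicity on positive elements, applied termwise, makes a representative of
  \<open>x\<close> a null sequence.\<close>

lemma seq_positive_eq_0I:
  assumes x: "seq_positive x"
    and y: "\<And>\<epsilon>. \<epsilon> > 0 \<Longrightarrow> \<exists>y. seq_positive y \<and> seq_bounded_by \<epsilon> (x + y)"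
  shows "x = 0"
proof -
  obtain f where f: "Bseq f" "\<And>n. cstar_positive (f n)" "x = abs_seq_alg f"
    using x by (auto simp: seq_positive_def)
  have "f \<longlonglongrightarrow> 0"
  proof (rule LIMSEQ_I)
    fix r :: real assume r: "0 < r"
    then obtain y where "seq_positive y" "seq_bounded_by (r/2) (x + y)"
      using y[of "r/2"] by auto
    then obtain g h where g: "Bseq g" "\<And>n. cstar_positive (g n)" "y = abs_seq_alg g"
      and h: "\<And>n. norm (h n) \<le> r/2" "x + y = abs_seq_alg h"
      by (auto simp: seq_positive_def seq_bounded_by_def)
    have "(\<lambda>n. (f n + g n) - h n) \<longlonglongrightarrow> 0"
      using h(2) f g by (subst abs_seq_alg_eq_iff[symmetric])
        (auto simp: abs_seq_alg_ops Bseq_closed BseqI'[OF h(1)])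
    from LIMSEQ_D[OF this half_gt_zero[OF r]]
    obtain M where M: "\<And>n. n \<ge> M \<Longrightarrow> norm ((f n + g n) - h n) < r/2"
      by auto
    have "norm (f n - 0) < r" if "n \<ge> M" for n
    proof -
      have "norm (f n) \<le> norm (f n + g n)"
        using f g by (intro cstar_positive_norm_mono)
      also have "\<dots> \<le> norm ((f n + g n) - h n) + norm (h n)"
        using norm_triangle_ineq[of "(f n + g n) - h n" "h n"] by simp
      finally show ?thesis
        using M[OF that] h(1)[of n] by simp
    qed
    then show "\<exists>M. \<forall>n\<ge>M. norm (f n - 0) < r" by blast
  qed
  then show ?thesis
    using f by (simp add: zero_seq_alg_abs abs_seq_alg_eq_iff Bfun_const)
qed

section \<open>Balanced positive forms\<close>

context cond_exp_basis
begin

text \<open>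
  A bounded positive \<open>P\<close>-balanced form \<open>g\<close> corresponds to the positive functional
  \<open>x e\<^sub>P y \<mapsto> g x y\<close> on the basic construction, and \<open>trace_form g T\<close> is its value at \<open>T\<close>.
\<close>

definition trace_form :: "('a \<Rightarrow> 'a \<Rightarrow> 'a seq_alg) \<Rightarrow> ('a \<Rightarrow> 'a) \<Rightarrow> 'a seq_alg" where
  "trace_form g T = (\<Sum>j<n. g (T (star (v j))) (star (u j)))"

context
  fixes g :: "'a \<Rightarrow> 'a \<Rightarrow> 'a seq_alg" and C :: real
  assumes g_add_left: "\<And>x x' y. g (x + x') y = g x y + g x' y"
    and g_add_right: "\<And>x y y'. g x (y + y') = g x y + g x y'"
    and g_scaleR: "\<And>r x y. g (r *\<^sub>R x) y = r *\<^sub>R g x y"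
    and g_balanced: "\<And>x p y. p \<in> P \<Longrightarrow> g (x * p) y = g x (p * y)"
    and g_positive: "\<And>x. seq_positive (g x (star x))"
    and g_bounded: "\<And>x y. seq_bounded_by (C * norm x * norm y) (g x y)"
begin

section \<open>Inequalities for balanced positive forms\<close>

lemma g_scaleR_right: "g x (r *\<^sub>R y) = r *\<^sub>R g x y"
  using g_balanced[OF P_scaleR[OF P_one], of x r y] by (simp add: g_scaleR)

lemma g_zero_left: "g 0 y = 0"
  using g_scaleR[of 0 0 y] by simp

lemma g_zero_right: "g y 0 = 0"
  using g_scaleR_right[of y 0 0] by simp

lemma g_sum_left: "g (\<Sum>i\<in>I. f i) y = (\<Sum>i\<in>I. g (f i) y)"
  by (induction I rule: infinite_finite_induct) (auto simp: g_zero_left g_add_left)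

lemma g_sum_right: "g x (\<Sum>i\<in>I. f i) = (\<Sum>i\<in>I. g x (f i))"
  by (induction I rule: infinite_finite_induct) (auto simp: g_zero_right g_add_right)

lemma g_diff_left: "g (x - x') y = g x y - g x' y"
  using g_add_left[of "x - x'" x' y] by simp

lemma g_diff_right: "g x (y - y') = g x y - g x y'"
  using g_add_right[of x "y - y'" y'] by simp

text \<open>Completing the square: the expression is \<open>M\<close> times the form at
  \<open>x * r\<close> plus \<open>1 / M\<close> times the form at
  \<open>z = x * q - M *\<^sub>R y\<close>, where \<open>r\<close> is a root of
  \<open>1 - p\<close>. The root is taken in \<open>P\<close> so that it can be moved across the
  form.\<close>

lemma form_cross_bound:
  assumes q: "q \<in> P" "norm q \<le> M" "0 < M"
  shows "seq_positive (M *\<^sub>R (g x (star x) + g y (star y)) - g (x * q) (star y) - g (y * star q) (star x))"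
proof -
  define p where "p = (1 / M\<^sup>2) *\<^sub>R (q * star q)"
  have "norm (q * star q) = (norm q)\<^sup>2"
    using cstar_identity[of "star q"] by (simp add: star_star norm_star)
  then have "norm p \<le> 1"
    using q power_mono[of "norm q" M 2] by (simp add: p_def)
  moreover have "p \<in> P" "star p = p"
    by (simp_all add: p_def star_simps P_scaleR P_mult P_star q)
  ultimately obtain r where r: "r \<in> P" "star r = r" "r * r = 1 - p"
    using P_sqrt by metis
  define z where "z = x * q - M *\<^sub>R y"
  have "g (x * r) (star (x * r)) = g (x * (r * r)) (star x)"
    using g_balanced[OF r(1), of "x * r" "star x"] by (simp add: star_mult r(2) mult.assoc)
  then have 1: "g (x * r) (star (x * r)) = g x (star x) - g (x * p) (star x)"
    by (simp add: r right_diff_distrib g_diff_left)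
  have pq: "g (x * p) (star x) = (1 / M\<^sup>2) *\<^sub>R g (x * q) (star q * star x)"
    by (simp add: p_def g_scaleR mult.assoc[symmetric] g_balanced P_star q(1))
  have 2: "g z (star z) = g (x * q) (star q * star x) - M *\<^sub>R g (x * q) (star y)
      - M *\<^sub>R g (y * star q) (star x) + M\<^sup>2 *\<^sub>R g y (star y)"
    by (simp add: z_def star_simps g_diff_left g_diff_right g_scaleR g_scaleR_right g_balanced
        P_star q(1) power2_eq_square algebra_simps)
  have "M *\<^sub>R (g x (star x) + g y (star y)) - g (x * q) (star y) - g (y * star q) (star x)
     = M *\<^sub>R g (x * r) (star (x * r)) + (1 / M) *\<^sub>R g z (star z)"
    using q(3) unfolding 1 2 pq by (simp add: algebra_simps power2_eq_square)
  also have "seq_positive \<dots>"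
    using q(3) by (intro seq_positive_add seq_positive_scaleR g_positive) auto
  finally show ?thesis .
qed

text \<open>The entries \<open>E (v k * star (v l))\<close> have norm at most
  \<open>M = frame_bound / n\<close>. Summing \<open>form_cross_bound\<close> over all ordered pairs
  counts everything twice, whence the factor \<open>1/2\<close>.\<close>

lemma form_gram_bound:
  "seq_positive (frame_bound *\<^sub>R (\<Sum>k<n. g (x k) (star (x k)))
     - (\<Sum>k<n. \<Sum>l<n. g (x k * E (v k * star (v l))) (star (x l))))"
proof (cases "n = 0")
  case False
  define M where "M = frame_bound / n"
  have M: "0 < M" "real n * M = frame_bound"
    using frame_bound_ge_1 False by (auto simp: M_def)
  let ?q = "\<lambda>k l. E (v k * star (v l))"
  let ?h = "\<lambda>k l. g (x k * ?q k l) (star (x l))"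
  let ?d = "\<lambda>k. g (x k) (star (x k))"
  have bound: "norm (?q k l) \<le> M" if "k < n" "l < n" for k l
  proof -
    have "(norm (v i))\<^sup>2 \<le> M" if "i < n" for i
      using norm_basis_le_frame_bound(2)[OF that] False by (simp add: M_def field_simps)
    then have "(norm (v k))\<^sup>2 \<le> M" "(norm (v l))\<^sup>2 \<le> M"
      using that by auto
    moreover have "2 * (norm (v k) * norm (v l)) \<le> (norm (v k))\<^sup>2 + (norm (v l))\<^sup>2"
      using sum_squares_bound[of "norm (v k)" "norm (v l)"] by (simp add: mult.assoc)
    ultimately have "norm (v k) * norm (v l) \<le> M" by linarith
    then show ?thesis
      using norm_E_le norm_mult_ineq[of "v k" "star (v l)"] by (metis norm_star order_trans)
  qed
  have sq: "star (?q k l) = ?q l k" for k l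
    by (simp add: star_simps flip: E_star)
  have "seq_positive (\<Sum>k<n. \<Sum>l<n. M *\<^sub>R (?d k + ?d l) - ?h k l - ?h l k)"
    using form_cross_bound[OF E_in bound M(1)]
    by (intro seq_positive_sum) (simp add: sq)
  also have "(\<Sum>k<n. \<Sum>l<n. M *\<^sub>R (?d k + ?d l) - ?h k l - ?h l k) =
     M *\<^sub>R ((\<Sum>k<n. \<Sum>l<n. ?d k) + (\<Sum>k<n. \<Sum>l<n. ?d l)) - (\<Sum>k<n. \<Sum>l<n. ?h k l) - (\<Sum>k<n. \<Sum>l<n. ?h l k)"
    by (simp only: sum_subtractf sum.distrib scaleR_sum_right scaleR_add_right)
  also have "(\<Sum>k<n. \<Sum>l<n. ?d k) = real n *\<^sub>R (\<Sum>k<n. ?d k)"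
    by (simp only: sum_constant_scaleR card_lessThan scaleR_sum_right)
  also have "(\<Sum>k<n. \<Sum>l<n. ?d l) = real n *\<^sub>R (\<Sum>k<n. ?d k)"
    by (simp only: sum_constant_scaleR card_lessThan)
  also have "(\<Sum>k<n. \<Sum>l<n. ?h l k) = (\<Sum>k<n. \<Sum>l<n. ?h k l)"
    by (rule sum.swap)
  finally have "seq_positive ((1/2) *\<^sub>R (M *\<^sub>R (real n *\<^sub>R (\<Sum>k<n. ?d k) + real n *\<^sub>R (\<Sum>k<n. ?d k))
      - (\<Sum>k<n. \<Sum>l<n. ?h k l) - (\<Sum>k<n. \<Sum>l<n. ?h k l)))"
    by (intro seq_positive_scaleR) auto
  also have "(1/2) *\<^sub>R (M *\<^sub>R (real n *\<^sub>R (\<Sum>k<n. ?d k) + real n *\<^sub>R (\<Sum>k<n. ?d k))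
      - (\<Sum>k<n. \<Sum>l<n. ?h k l) - (\<Sum>k<n. \<Sum>l<n. ?h k l)) =
      (real n * M) *\<^sub>R (\<Sum>k<n. ?d k) - (\<Sum>k<n. \<Sum>l<n. ?h k l)" (is "?lhs = ?rhs")
  proof -
    have "2 *\<^sub>R ?lhs = 2 *\<^sub>R ?rhs"
      unfolding scaleR_2 by (simp add: algebra_simps flip: scaleR_add_left)
    then show ?thesis by simp
  qed
  finally show ?thesis by (simp add: M(2))
qed (simp add: seq_positive_zero)

text \<open>Balance moves \<open>E (y * star (v j))\<close> into the second slot, where the
  quasi-basis expansion reassembles \<open>y\<close>.\<close>

lemma trace_form_rank_one: "trace_form g (\<lambda>a. x * E (y * a)) = g x y"
  using g_sum_right[of x "\<lambda>j. E (y * star (v j)) * star (u j)" "{..<n}"]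
  by (simp add: trace_form_def g_balanced E_in basis_star_right)

lemma trace_form_sum: "trace_form g (\<lambda>a. \<Sum>i\<in>I. T i a) = (\<Sum>i\<in>I. trace_form g (T i))"
  unfolding trace_form_def g_sum_left by (rule sum.swap)

text \<open>Writing \<open>K\<close> for \<open>relax\<close> and \<open>F\<close> for
  \<open>frame\<close>, the operators differ by \<open>2 t F - t\<^sup>2 F\<^sup>2\<close> placed
  between two copies of \<open>K ^^ m\<close>. Both parts are sums of rank-one maps, whose traces
  are known.\<close>

lemma trace_form_relax_step:
  fixes m :: nat
  defines "X \<equiv> \<lambda>k. (relax ^^ m) (star (v k))" and "t \<equiv> 1 / frame_bound"
  shows "trace_form g (relax ^^ (m + m)) - trace_form g (relax ^^ (Suc m + Suc m)) =
    2 *\<^sub>R (t *\<^sub>R (\<Sum>k<n. g (X k) (star (X k)))) -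
    (t * t) *\<^sub>R (\<Sum>k<n. \<Sum>l<n. g (X k * E (v k * star (v l))) (star (X l)))"
proof -
  let ?K = "relax ^^ m"
  \<comment> \<open>Self-adjointness moves the inner power of \<open>relax\<close> onto
    \<open>star (v k)\<close>, so both sides of each rank-one map are expressed through
    \<open>X\<close>.\<close>
  have coeff: "E (v k * ?K a) = E (star (X k) * a)" for k a
    using relax_power_self_adjoint[of m "star (v k)" a] by (simp add: X_def star_star)
  have F: "?K (frame b) = (\<Sum>k<n. X k * E (v k * b))" for b
    by (simp add: frame_def relax_power_sum relax_power_module E_in X_def)
  have F1: "?K (frame (?K a)) = (\<Sum>k<n. X k * E (star (X k) * a))" for a
    by (simp add: F coeff)
  have F2: "?K (frame (frame (?K a))) =
      (\<Sum>k<n. \<Sum>l<n. X k * E (v k * star (v l)) * E (star (X l) * a))" for a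
  proof -
    have "E (v k * frame (?K a)) = (\<Sum>l<n. E (v k * star (v l)) * E (star (X l) * a))" for k
      by (simp add: frame_def sum_distrib_left E_sum E_mult_right E_in coeff flip: mult.assoc)
    then show ?thesis
      by (simp add: F sum_distrib_left mult.assoc)
  qed
  have rr: "relax (relax b) = b - 2 *\<^sub>R (t *\<^sub>R frame b) + (t * t) *\<^sub>R frame (frame b)" for b
    unfolding relax_def t_def[symmetric] scaleR_2 by (simp add: frame_diff frame_scaleR algebra_simps)
  have "(relax ^^ (Suc m + Suc m)) a = ?K (relax (relax (?K a)))" for a
    by (simp add: funpow_add funpow_swap1)
  then have K2: "(relax ^^ (Suc m + Suc m)) a = (relax ^^ (m + m)) a
      - 2 *\<^sub>R (t *\<^sub>R (\<Sum>k<n. X k * E (star (X k) * a)))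
      + (t * t) *\<^sub>R (\<Sum>k<n. \<Sum>l<n. X k * E (v k * star (v l)) * E (star (X l) * a))" for a
    by (simp only: rr relax_power_add relax_power_diff relax_power_scaleR F1 F2 funpow_add comp_apply)
  have T1: "trace_form g (\<lambda>a. \<Sum>k<n. X k * E (star (X k) * a)) = (\<Sum>k<n. g (X k) (star (X k)))"
    by (simp only: trace_form_sum trace_form_rank_one)
  have T2: "trace_form g (\<lambda>a. \<Sum>k<n. \<Sum>l<n. X k * E (v k * star (v l)) * E (star (X l) * a)) =
      (\<Sum>k<n. \<Sum>l<n. g (X k * E (v k * star (v l))) (star (X l)))"
    by (simp only: trace_form_sum trace_form_rank_one)
  have "trace_form g (relax ^^ (Suc m + Suc m)) = trace_form g (relax ^^ (m + m))
      - 2 *\<^sub>R (t *\<^sub>R (\<Sum>k<n. g (X k) (star (X k))))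
      + (t * t) *\<^sub>R (\<Sum>k<n. \<Sum>l<n. g (X k * E (v k * star (v l))) (star (X l)))"
    unfolding T1[symmetric] T2[symmetric] trace_form_def K2
    by (simp only: g_add_left g_diff_left g_scaleR sum.distrib sum_subtractf scaleR_sum_right[symmetric])
  then show ?thesis by simp
qed

text \<open>The Gram term costs at most one of the two copies of \<open>t\<close> times the diagonal
  sum, because \<open>t * t * frame_bound = t\<close>.\<close>

lemma trace_form_relax_decrease:
  "seq_positive (trace_form g (relax ^^ (m + m)) - trace_form g (relax ^^ (Suc m + Suc m)) -
    (1 / frame_bound) *\<^sub>R (\<Sum>k<n. g ((relax ^^ m) (star (v k))) (star ((relax ^^ m) (star (v k))))))"
proof -
  define t where "t = 1 / frame_bound"
  have t: "t > 0" "t * t * frame_bound = t"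
    using frame_bound_ge_1 by (auto simp: t_def)
  define X where "X = (\<lambda>k. (relax ^^ m) (star (v k)))"
  let ?S = "\<Sum>k<n. g (X k) (star (X k))"
  let ?H = "\<Sum>k<n. \<Sum>l<n. g (X k * E (v k * star (v l))) (star (X l))"
  have "trace_form g (relax ^^ (m + m)) - trace_form g (relax ^^ (Suc m + Suc m)) - t *\<^sub>R ?S =
      (t * t) *\<^sub>R (frame_bound *\<^sub>R ?S - ?H)"
    unfolding trace_form_relax_step X_def t_def[symmetric] scaleR_2
    by (simp add: scaleR_diff_right t(2))
  also have "seq_positive \<dots>"
    using t(1) by (intro seq_positive_scaleR form_gram_bound) auto
  finally show ?thesis by (simp only: X_def t_def)
qed

text \<open>The traces \<open>\<phi> m\<close> start at \<open>0\<close>, decrease and tend to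
  \<open>0\<close>. Hence every decrement vanishes, and the first one dominates \<open>t\<close>
  times the value in question.\<close>

lemma form_eq_0:
  assumes trace: "trace_form g (\<lambda>a. a) = 0" and k: "k < n"
  shows "g (star (v k)) (v k) = 0"
proof -
  define t where "t = 1 / frame_bound"
  have t: "t > 0"
    using frame_bound_ge_1 by (auto simp: t_def)
  define S where "S m = (\<Sum>k<n. g ((relax ^^ m) (star (v k))) (star ((relax ^^ m) (star (v k)))))" for m
  define \<phi> where "\<phi> m = trace_form g (relax ^^ (m + m))" for m
  define D where "D m = \<phi> m - \<phi> (Suc m) - t *\<^sub>R S m" for m
  have S_pos: "seq_positive (S m)" for m
    unfolding S_def by (intro seq_positive_sum g_positive)
  have D_pos: "seq_positive (D m)" for m
    unfolding D_def \<phi>_def S_def t_def by (rule trace_form_relax_decrease)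
  have "\<phi> 0 = 0"
    using trace by (simp add: \<phi>_def trace_form_def)
  then have tele: "- \<phi> (Suc M) = (\<Sum>m<Suc M. t *\<^sub>R S m + D m)" for M
    using sum_lessThan_telescope'[of \<phi> "Suc M"] by (simp add: D_def del: sum.lessThan_Suc)
  define R where "R = (\<Sum>j\<in>{..<n} - {k}. g (star (v j)) (v j))"
  have S0: "S 0 = g (star (v k)) (v k) + R"
    using k unfolding S_def R_def by (subst sum.remove[of _ k]) (auto simp: star_star)
  have posv: "seq_positive (g (star (v j)) (v j))" for j
    using g_positive[of "star (v j)"] by (simp add: star_star)
  have R_pos: "seq_positive R"
    unfolding R_def by (intro seq_positive_sum posv)
  \<comment> \<open>Boundedness of \<open>g\<close> transfers the convergence of the relaxed
    \<open>star (v j)\<close> to the traces.\<close>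
  define B where "B m = (\<Sum>j<n. C * norm ((relax ^^ m) (star (v j))) * norm (star (u j)))" for m
  have B: "seq_bounded_by (B (M + M)) (\<phi> M)" for M
    unfolding B_def \<phi>_def trace_form_def by (intro seq_bounded_by_sum g_bounded)
  have "B \<longlonglongrightarrow> (\<Sum>j<n. C * norm (0 :: 'a) * norm (star (u j)))"
    unfolding B_def by (intro tendsto_intros relax_power_tendsto_0)
  then have B0: "B \<longlonglongrightarrow> 0" by simp
  have "t *\<^sub>R g (star (v k)) (v k) = 0"
  proof (rule seq_positive_eq_0I)
    show "seq_positive (t *\<^sub>R g (star (v k)) (v k))"
      using t by (intro seq_positive_scaleR posv) auto
    fix \<epsilon> :: real assume "\<epsilon> > 0"
    then obtain M where "\<And>m. m \<ge> M \<Longrightarrow> norm (B m - 0) < \<epsilon>"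
      using LIMSEQ_D[OF B0] by blast
    from this[of "Suc M + Suc M"] have "B (Suc M + Suc M) \<le> \<epsilon>" by auto
    then have bd: "seq_bounded_by \<epsilon> (- \<phi> (Suc M))"
      using B seq_bounded_by_mono seq_bounded_by_uminus by blast
    \<comment> \<open>These are the summands of \<open>- \<phi> (Suc M)\<close> other than the one
      to be shown zero; all are positive.\<close>
    define Y where "Y = t *\<^sub>R R + D 0 + (\<Sum>m<M. t *\<^sub>R S (Suc m) + D (Suc m))"
    have "seq_positive Y"
      unfolding Y_def using t
      by (intro seq_positive_add seq_positive_sum seq_positive_scaleR R_pos D_pos S_pos) auto
    moreover have "- \<phi> (Suc M) = t *\<^sub>R g (star (v k)) (v k) + Y"
      unfolding tele sum.lessThan_Suc_shift S0 Y_def by (simp add: algebra_simps)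
    ultimately show "\<exists>y. seq_positive y \<and> seq_bounded_by \<epsilon> (t *\<^sub>R g (star (v k)) (v k) + y)"
      using bd by auto
  qed
  then show ?thesis using t by simp
qed

end

end

section \<open>The Rohlin projection\<close>

context cond_exp_basis
begin

section \<open>The termwise expectation on the sequence algebra\<close>

abbreviation E_seq :: "'a seq_alg \<Rightarrow> 'a seq_alg" where
  "E_seq \<equiv> induced_seq_map E"

lemmas E_seq_abs = induced_seq_map_abs[OF expectation]
lemmas E_seq_in = induced_seq_map_in_seq_subalg[OF expectation]

lemma Bseq_E: "Bseq f \<Longrightarrow> Bseq (\<lambda>n. E (f n))"
  using conditional_expectation_seq_rel[OF expectation, of f f] by (simp add: seq_rel_refl_iff)

lemma E_seq_add: "E_seq (x + y) = E_seq x + E_seq y"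
  by (rule seq_alg_cases[of x], rule seq_alg_cases[of y])
     (simp add: E_seq_abs abs_seq_alg_ops Bseq_closed Bseq_E E_add)

lemma E_seq_diff: "E_seq (x - y) = E_seq x - E_seq y"
  by (rule seq_alg_cases[of x], rule seq_alg_cases[of y])
     (simp add: E_seq_abs abs_seq_alg_ops Bseq_closed Bseq_E E_diff)

lemma E_seq_scaleR: "E_seq (r *\<^sub>R x) = r *\<^sub>R E_seq x"
  by (rule seq_alg_cases[of x])
     (simp add: E_seq_abs abs_seq_alg_ops Bseq_closed Bseq_E E_scaleR)

lemma E_seq_sum: "E_seq (\<Sum>i\<in>I. f i) = (\<Sum>i\<in>I. E_seq (f i))"
  using E_seq_diff[of 0 0]
  by (induction I rule: infinite_finite_induct) (auto simp: E_seq_add)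

lemma E_seq_mult_left: "p \<in> seq_subalg P \<Longrightarrow> E_seq (p * x) = p * E_seq x"
  by (rule seq_alg_cases[of x])
     (auto simp: seq_subalg_def E_seq_abs abs_seq_alg_ops Bseq_closed Bseq_E E_mult_left image_subset_iff)

lemma E_seq_mult_right: "p \<in> seq_subalg P \<Longrightarrow> E_seq (x * p) = E_seq x * p"
  by (rule seq_alg_cases[of x])
     (auto simp: seq_subalg_def E_seq_abs abs_seq_alg_ops Bseq_closed Bseq_E E_mult_right image_subset_iff)

lemma const_seq_in: "p \<in> P \<Longrightarrow> const_seq p \<in> seq_subalg P"
  by (auto simp: seq_subalg_def const_seq_abs Bfun_const)

lemma star_in_seq_subalg: "x \<in> seq_subalg P \<Longrightarrow> star x \<in> seq_subalg P"
  by (fastforce simp: seq_subalg_def abs_seq_alg_ops Bseq_closed intro: P_star)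

lemma E_seq_positive: "seq_positive x \<Longrightarrow> seq_positive (E_seq x)"
  unfolding seq_positive_def by (metis E_seq_abs Bseq_E E_positive)

lemma E_seq_bounded: "seq_bounded_by r x \<Longrightarrow> seq_bounded_by r (E_seq x)"
  unfolding seq_bounded_by_def by (metis E_seq_abs norm_E_le order_trans BseqI')

lemma E_seq_basis_star: "(\<Sum>j<n. E_seq (z * const_seq (star (v j))) * const_seq (star (u j))) = z"
proof -
  obtain f where f: "Bseq f" "z = abs_seq_alg f" by (rule seq_alg_cases)
  \<comment> \<open>Boundedness is carried through the induction because classes are added termwise
    only for bounded representatives.\<close>
  have "(\<Sum>j\<in>J. E_seq (z * const_seq (star (v j))) * const_seq (star (u j))) =
      abs_seq_alg (\<lambda>m. \<Sum>j\<in>J. E (f m * star (v j)) * star (u j)) \<and>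
      Bseq (\<lambda>m. \<Sum>j\<in>J. E (f m * star (v j)) * star (u j))" if "finite J" for J
    using that
  proof (induction J)
    case (insert j J)
    then show ?case
      by (simp add: f const_seq_abs E_seq_abs abs_seq_alg_ops Bseq_closed Bseq_E Bfun_const)
  qed (simp add: zero_seq_alg_abs Bfun_const)
  from this[of "{..<n}"] show ?thesis
    by (simp add: basis_star_right f)
qed

end

locale rohlin_basis = cond_exp_basis +
  fixes e :: "'a seq_alg" and c :: 'a
  assumes e_central: "e \<in> central_seq_alg"
    and e_projection: "projection e"
    and c_index: "c * index = 1"
    and E_seq_e: "E_seq e = const_seq c"
begin

section \<open>The index, the map \<open>\<beta>\<close> and its defect\<close>

lemma e_commute: "e * const_seq a = const_seq a * e"
  and e_idem: "e * e = e"
  and e_star: "star e = e"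
  using e_central e_projection by (auto simp: central_seq_alg_def projection_def)

lemma c_in_P: "c \<in> P"
proof -
  obtain f where f: "Bseq f" "e = abs_seq_alg f" by (rule seq_alg_cases)
  then have "(\<lambda>m. E (f m) - c) \<longlonglongrightarrow> 0"
    using E_seq_e by (simp add: E_seq_abs const_seq_abs abs_seq_alg_eq_iff Bseq_E Bfun_const)
  then have "(\<lambda>m. E (f m)) \<longlonglongrightarrow> c"
    using LIM_zero_iff by blast
  then show ?thesis
    by (rule closed_sequentially[OF P_closed E_in])
qed

lemma index_c: "index * c = 1"
  using c_index index_central[of c] by simp

text \<open>Applying \<open>E\<close> to \<open>c * index = 1\<close> shows that
  \<open>E index\<close> inverts \<open>c\<close> as well, hence equals
  \<open>index\<close>.\<close>

lemma index_in_P: "index \<in> P"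
proof -
  have "c * E index = 1"
    using E_mult_left[OF c_in_P, of index] by (simp add: c_index E_id P_one)
  then have "index * c * E index = index"
    by (simp add: mult.assoc)
  then have "E index = index"
    by (simp add: index_c)
  then show ?thesis using E_in[of index] by simp
qed

text \<open>
  The aim is \<open>x e = \<beta> x e\<close>, i.e. that the defect \<open>\<xi>\<close> vanishes; this makes \<open>\<beta>\<close> multiplicative.
\<close>

definition \<beta> :: "'a \<Rightarrow> 'a seq_alg" where
  "\<beta> x = E_seq (const_seq (index * x) * e)"

definition \<xi> :: "'a \<Rightarrow> 'a seq_alg" where
  "\<xi> x = (const_seq x - \<beta> x) * e"

lemma \<beta>_in: "\<beta> x \<in> seq_subalg P"
  unfolding \<beta>_def by (rule E_seq_in)

lemma \<beta>_add: "\<beta> (x + y) = \<beta> x + \<beta> y"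
  by (simp add: \<beta>_def distrib_left distrib_right const_seq_add E_seq_add)

lemma \<beta>_scaleR: "\<beta> (r *\<^sub>R x) = r *\<^sub>R \<beta> x"
  by (simp add: \<beta>_def const_seq_scaleR E_seq_scaleR)

lemma \<beta>_module: "p \<in> P \<Longrightarrow> \<beta> (x * p) = \<beta> x * const_seq p"
proof -
  assume p: "p \<in> P"
  have "const_seq (index * (x * p)) * e = const_seq (index * x) * e * const_seq p"
    by (simp add: const_seq_mult mult.assoc e_commute)
  then show ?thesis
    by (simp add: \<beta>_def E_seq_mult_right const_seq_in p)
qed

text \<open>The factor \<open>index\<close> in \<open>\<beta>\<close> cancels
  \<open>E_seq e\<close>, so \<open>\<beta> 1 = 1\<close>; the module property does the
  rest.\<close>

lemma \<beta>_P: "p \<in> P \<Longrightarrow> \<beta> p = const_seq p"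
proof -
  have "\<beta> 1 = const_seq index * const_seq c"
    by (simp add: \<beta>_def E_seq_mult_left const_seq_in index_in_P E_seq_e)
  then show "p \<in> P \<Longrightarrow> \<beta> p = const_seq p"
    using \<beta>_module[of p 1] by (simp add: index_c const_seq_one flip: const_seq_mult)
qed

lemma \<xi>_add: "\<xi> (x + y) = \<xi> x + \<xi> y"
  by (simp add: \<xi>_def \<beta>_add const_seq_add algebra_simps)

lemma \<xi>_scaleR: "\<xi> (r *\<^sub>R x) = r *\<^sub>R \<xi> x"
  by (simp add: \<xi>_def \<beta>_scaleR const_seq_scaleR algebra_simps)

lemma \<xi>_module: "p \<in> P \<Longrightarrow> \<xi> (x * p) = \<xi> x * const_seq p"
  by (simp add: \<xi>_def \<beta>_module const_seq_mult mult.assoc e_commute flip: left_diff_distrib)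

lemma \<xi>_e: "\<xi> x * e = \<xi> x"
  by (simp add: \<xi>_def mult.assoc e_idem)

text \<open>Multiplying \<open>\<beta> x\<close> by \<open>const_seq c\<close> cancels the index and
  leaves \<open>E_seq (const_seq x * e)\<close>.\<close>

lemma E_seq_\<xi>: "E_seq (\<xi> x) = 0"
proof -
  have "\<beta> x * const_seq c = E_seq (const_seq (index * x) * const_seq c * e)"
    unfolding \<beta>_def using e_commute[of c]
    by (simp add: mult.assoc const_seq_in c_in_P flip: E_seq_mult_right)
  also have "const_seq (index * x) * const_seq c = const_seq x"
    using index_central[of x] by (simp add: mult.assoc index_c flip: const_seq_mult)
  finally show ?thesis
    by (simp add: \<xi>_def left_diff_distrib E_seq_diff E_seq_mult_left[OF \<beta>_in] E_seq_e)
qed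

text \<open>The projection in the second factor is absorbed by \<open>\<xi> x\<close>; the part with
  \<open>\<beta>\<close> factors out of \<open>E_seq\<close>, leaving
  \<open>E_seq (\<xi> x)\<close>, which is \<open>0\<close>.\<close>

lemma E_seq_\<xi>_\<xi>: "E_seq (\<xi> x * star (\<xi> (star y))) = E_seq (\<xi> x * const_seq y)"
proof -
  have "\<xi> x * star (\<xi> (star y)) = \<xi> x * const_seq y - \<xi> x * star (\<beta> (star y))"
    unfolding \<xi>_def[of "star y"]
    by (simp add: star_simps e_star const_seq_star \<xi>_e right_diff_distrib flip: mult.assoc)
  then show ?thesis
    by (simp add: E_seq_diff E_seq_mult_right[OF star_in_seq_subalg[OF \<beta>_in]] E_seq_\<xi>)
qed

lemma \<xi>_eq_0: "\<xi> x = 0"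
proof -
  \<comment> \<open>The inner \<open>star\<close> compensates the outer one: \<open>g\<close> is
    balanced over \<open>P\<close>, and \<open>g x (star x)\<close> is the expectation of a positive
    element.\<close>
  define g where "g x y = E_seq (\<xi> x * star (\<xi> (star y)))" for x y
  obtain B where B: "0 \<le> B" "seq_bounded_by B e" by (rule seq_bounded_by_exists)
  define C where "C = (1 + norm index * B) * B"
  have \<xi>_bound: "seq_bounded_by (C * norm x) (\<xi> x)" for x
  proof -
    have "norm (index * x) * B \<le> norm index * norm x * B"
      using B(1) norm_mult_ineq by (intro mult_right_mono)
    with seq_bounded_by_mult[OF seq_bounded_by_const B(2)]
    have "seq_bounded_by (norm index * norm x * B) (\<beta> x)"
      unfolding \<beta>_def by (intro E_seq_bounded) (rule seq_bounded_by_mono)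
    from seq_bounded_by_mult[OF seq_bounded_by_add[OF seq_bounded_by_const[of x]
          seq_bounded_by_uminus[OF this]] B(2)]
    show ?thesis by (simp add: \<xi>_def C_def algebra_simps)
  qed
  have "g (star (v k)) (v k) = 0" if "k < n" for k
  proof (rule form_eq_0[where g = g and C = "C * C"])
    show "g (x + x') y = g x y + g x' y" for x x' y
      by (simp add: g_def \<xi>_add distrib_right E_seq_add)
    show "g x (y + y') = g x y + g x y'" for x y y'
      by (simp add: g_def \<xi>_add star_simps distrib_left E_seq_add)
    show "g (r *\<^sub>R x) y = r *\<^sub>R g x y" for r x y
      by (simp add: g_def \<xi>_scaleR E_seq_scaleR)
    show "g (x * p) y = g x (p * y)" if "p \<in> P" for x p y
      using that by (simp add: g_def star_simps \<xi>_module P_star const_seq_star mult.assoc)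
    show "seq_positive (g x (star x))" for x
      using seq_positive_star_mult[of "star (\<xi> x)"] by (simp add: g_def star_star E_seq_positive)
    show "seq_bounded_by (C * C * norm x * norm y) (g x y)" for x y
      using E_seq_bounded[OF seq_bounded_by_mult[OF \<xi>_bound seq_bounded_by_star[OF \<xi>_bound]], of x "star y"]
      by (simp add: g_def norm_star algebra_simps)
    \<comment> \<open>The trace vanishes: expanding \<open>const_seq index * e\<close> in the
      quasi-basis has the coefficients \<open>\<beta> (star (v j))\<close>, so the sum of defects is
      \<open>const_seq index * e - const_seq index * e * e\<close>.\<close>
    have "(\<Sum>j<n. star (v j) * star (u j)) = index"
      using star_index by (simp add: index_def star_sum star_mult)
    moreover have "(\<Sum>j<n. \<beta> (star (v j)) * const_seq (star (u j))) = const_seq index * e"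
      using E_seq_basis_star[of "const_seq index * e"]
      by (simp add: \<beta>_def const_seq_mult mult.assoc e_commute)
    moreover have "(\<Sum>j<n. \<xi> (star (v j)) * const_seq (star (u j))) =
        const_seq (\<Sum>j<n. star (v j) * star (u j)) * e
        - (\<Sum>j<n. \<beta> (star (v j)) * const_seq (star (u j))) * e"
      by (simp add: \<xi>_def const_seq_sum sum_distrib_right const_seq_mult mult.assoc e_commute
          left_diff_distrib sum_subtractf)
    ultimately have "(\<Sum>j<n. \<xi> (star (v j)) * const_seq (star (u j))) = 0"
      by (simp add: mult.assoc e_idem)
    moreover have "trace_form g (\<lambda>a. a) = E_seq (\<Sum>j<n. \<xi> (star (v j)) * const_seq (star (u j)))"
      unfolding trace_form_def g_def E_seq_\<xi>_\<xi> E_seq_sum ..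
    ultimately show "trace_form g (\<lambda>a. a) = 0"
      using E_seq_diff[of 0 0] by simp
  qed fact
  then have sq: "E_seq (\<xi> (star (v k)) * star (\<xi> (star (v k)))) = 0" if "k < n" for k
    using that by (simp add: g_def)
  \<comment> \<open>\<open>norm_le_expectation\<close> holds termwise with one constant, so
    faithfulness of \<open>E\<close> passes to the sequence algebra.\<close>
  have \<xi>_v: "\<xi> (star (v k)) = 0" if "k < n" for k
  proof -
    obtain f where f: "Bseq f" "\<xi> (star (v k)) = abs_seq_alg f" by (rule seq_alg_cases)
    then have "(\<lambda>m. E (f m * star (f m))) \<longlonglongrightarrow> 0"
      using sq[OF that]
      by (simp add: abs_seq_alg_ops Bseq_closed Bseq_E E_seq_abs zero_seq_alg_abs abs_seq_alg_eq_iff Bfun_const)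
    then have "(\<lambda>m. frame_bound\<^sup>2 * norm (E (f m * star (f m)))) \<longlonglongrightarrow> 0"
      by (intro tendsto_mult_right_zero tendsto_norm_zero)
    moreover have "norm ((norm (f m))\<^sup>2) \<le> frame_bound\<^sup>2 * norm (E (f m * star (f m)))" for m
      using norm_le_expectation[of "star (f m)"] by (simp add: star_star norm_star)
    ultimately have "(\<lambda>m. (norm (f m))\<^sup>2) \<longlonglongrightarrow> 0"
      by (intro Lim_null_comparison[of "\<lambda>m. (norm (f m))\<^sup>2"]) auto
    from tendsto_real_sqrt[OF this] have "f \<longlonglongrightarrow> 0"
      by (simp add: tendsto_norm_zero_iff)
    then show ?thesis
      using f by (simp add: zero_seq_alg_abs abs_seq_alg_eq_iff Bfun_const)
  qed
  have \<xi>_sum: "\<xi> (\<Sum>i\<in>I. f i) = (\<Sum>i\<in>I. \<xi> (f i))" for f and I :: "nat set"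
    using \<xi>_scaleR[of 0 0] by (induction I rule: infinite_finite_induct) (auto simp: \<xi>_add)
  \<comment> \<open>The coefficients of this expansion stand on the right and lie in
    \<open>P\<close>, so they factor out of \<open>\<xi>\<close>.\<close>
  have "x = (\<Sum>i<n. star (v i) * E (star (u i) * x))"
    using basis_star by (simp add: quasi_basis_def)
  then have "\<xi> x = (\<Sum>i<n. \<xi> (star (v i) * E (star (u i) * x)))"
    using \<xi>_sum by metis
  then show ?thesis
    by (simp add: \<xi>_module E_in \<xi>_v)
qed

text \<open>Since \<open>\<beta> x * e = const_seq x * e\<close>, pulling \<open>\<beta> x\<close>
  into the expectation defining \<open>\<beta> y\<close> replaces it by \<open>x\<close>; centrality
  of \<open>index\<close> then gives \<open>\<beta> (x * y)\<close>.\<close>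

lemma \<beta>_mult: "\<beta> (x * y) = \<beta> x * \<beta> y"
proof -
  have "\<beta> x * e = const_seq x * e"
    using \<xi>_eq_0[of x] by (simp add: \<xi>_def algebra_simps)
  then have "\<beta> x * (const_seq (index * y) * e) = const_seq x * const_seq (index * y) * e"
    by (metis e_commute mult.assoc)
  also have "const_seq x * const_seq (index * y) = const_seq (index * (x * y))"
    using index_central[of x] by (simp flip: const_seq_mult mult.assoc)
  finally show ?thesis
    unfolding \<beta>_def[of "x * y"] by (simp add: \<beta>_def[of y] flip: E_seq_mult_left[OF \<beta>_in])
qed

section \<open>Transfer of stable rank one\<close>

lemma tsr_eq_1_subalgebra:
  assumes "tsr_eq_1 (UNIV :: 'a set)"
  shows "tsr_eq_1 P"
  unfolding tsr_eq_1_def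
proof
  fix x assume x: "x \<in> P"
  show "x \<in> closure (invertibles_of P)"
    unfolding closure_approachable
  proof (intro allI impI)
    fix \<epsilon> :: real assume \<epsilon>: "0 < \<epsilon>"
    obtain f where f: "Bseq f" "e = abs_seq_alg f" by (rule seq_alg_cases)
    then obtain B where B: "0 < B" "\<And>m. norm (f m) \<le> B" by (auto simp: Bseq_def)
    \<comment> \<open>\<open>L\<close> is a Lipschitz constant, uniform in \<open>m\<close>, for the
      maps \<open>\<lambda>a. b a m\<close> introduced below; the summand \<open>1\<close> keeps it
      positive.\<close>
    define L where "L = (1 + norm index) * B"
    define \<delta> where "\<delta> = \<epsilon> / (2 * L)"
    have "0 < L"
      unfolding L_def using B(1) by (intro mult_pos_pos) (auto intro: add_pos_nonneg)
    then have \<delta>: "\<delta> > 0" "L * \<delta> = \<epsilon> / 2"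
      using \<epsilon> by (simp_all add: \<delta>_def)
    obtain y where "y \<in> invertibles_of UNIV" and y: "dist y x < \<delta>"
      using assms \<delta>(1) unfolding tsr_eq_1_def by (metis closure_approachable UNIV_I subsetD)
    then obtain z where z: "y * z = 1" "z * y = 1"
      by (auto simp: invertibles_of_def)
    define b where "b a m = E (index * a * f m)" for a m
    have Bseq_b: "Bseq (b a)" for a
      unfolding b_def by (intro Bseq_E Bseq_mult' Bfun_const f(1))
    have \<beta>_b: "\<beta> a = abs_seq_alg (b a)" for a
    proof -
      have "\<beta> a = E_seq (const_seq (index * a) * abs_seq_alg f)"
        by (simp only: \<beta>_def flip: f(2))
      then show ?thesis
        by (simp add: b_def[abs_def] const_seq_abs abs_seq_alg_mult E_seq_abs Bseq_mult' Bfun_const f(1))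
    qed
    \<comment> \<open>As \<open>\<beta>\<close> is multiplicative and unital, an inverse pair
      becomes an approximate inverse pair of terms in \<open>P\<close>.\<close>
    have lim: "(\<lambda>m. b s m * b t m - 1) \<longlonglongrightarrow> 0" if "s * t = 1" for s t
    proof -
      have "abs_seq_alg (\<lambda>m. b s m * b t m) = abs_seq_alg (\<lambda>_. 1)"
        using \<beta>_mult[of s t] \<beta>_P[OF P_one] that
        by (simp add: \<beta>_b abs_seq_alg_mult Bseq_b const_seq_abs)
      then show ?thesis
        by (simp add: abs_seq_alg_eq_iff Bseq_mult' Bseq_b Bfun_const)
    qed
    have lim_x: "(\<lambda>m. b x m - x) \<longlonglongrightarrow> 0"
      using \<beta>_P[OF x] by (simp add: \<beta>_b const_seq_abs abs_seq_alg_eq_iff Bseq_b Bfun_const)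
    from tendstoD[OF lim[OF z(1)] zero_less_one] tendstoD[OF lim[OF z(2)] zero_less_one]
      tendstoD[OF lim_x half_gt_zero[OF \<epsilon>]]
    have "\<forall>\<^sub>F m in sequentially. norm (b y m * b z m - 1) < 1 \<and>
        norm (b z m * b y m - 1) < 1 \<and> norm (b x m - x) < \<epsilon> / 2"
      by eventually_elim (simp add: dist_norm)
    then obtain m where m: "norm (b y m * b z m - 1) < 1" "norm (b z m * b y m - 1) < 1"
        "norm (b x m - x) < \<epsilon> / 2"
      by (auto dest: eventually_happens)
    have "b y m \<in> invertibles_of P"
      using m(1,2) by (intro P_invertible_if_almost[of _ "b z m"]) (simp_all add: b_def E_in)
    moreover have "dist (b y m) x < \<epsilon>"
    proof -
      have "norm (b y m - b x m) = norm (E (index * (y - x) * f m))"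
        by (simp add: b_def algebra_simps flip: E_diff)
      also have "\<dots> \<le> norm (index * (y - x) * f m)"
        by (rule norm_E_le)
      also have "\<dots> \<le> norm (index * (y - x)) * norm (f m)"
        by (rule norm_mult_ineq)
      also have "\<dots> \<le> (norm index * norm (y - x)) * B"
        by (intro mult_mono norm_mult_ineq B) auto
      also have "\<dots> \<le> ((1 + norm index) * \<delta>) * B"
        using y B(1) \<delta>(1) by (intro mult_mono) (auto simp: dist_norm)
      also have "\<dots> = \<epsilon> / 2"
        unfolding \<delta>(2)[symmetric] by (simp add: L_def)
      finally have "norm (b y m - b x m) \<le> \<epsilon> / 2" .
      then show ?thesis
        using norm_triangle_ineq[of "b y m - b x m" "b x m - x"] m(3) by (simp add: dist_norm)
    qed
    ultimately show "\<exists>y\<in>invertibles_of P. dist y x < \<epsilon>" by blast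
  qed
qed

end

theorem theorem5p9:
  fixes P :: "'a :: unital_cstar_algebra set"
  assumes "unital_cstar_subalgebra P"
    and "inclusion_rohlin P"
    and "tsr_eq_1 (UNIV :: 'a set)"
  shows "tsr_eq_1 P"
proof -
  obtain E e c where E: "conditional_expectation P E" "finite_index E"
    and e: "e \<in> central_seq_alg" "projection e" "induced_seq_map E e = const_seq c"
    and c: "c * cond_exp_index E = 1"
    using assms(2) by (auto simp: inclusion_rohlin_def expectation_rohlin_def)
  obtain n u v where basis: "quasi_basis E n u v"
    using E(2) by (auto simp: finite_index_def)
  interpret cond_exp_basis P E n u v
    using assms(1) E(1) basis by unfold_locales
  interpret rohlin_basis P E n u v e c
    using e c cond_exp_index_eq[OF basis] by unfold_locales (simp_all add: index_def)
  show ?thesis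
    by (rule tsr_eq_1_subalgebra[OF assms(3)])
qed

end
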